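(* Let $P_{n,N}$ be the random polytope in $\mathbb{R}^n$ defined by $$P_{n,N}:=\bigcap_{i=1}^{N}\{x\in\mathbb{R}^n:\ \langle X_i,x\rangle\le t_{n,N}\},\qquad X_1,\ldots,X_N\ \text{i.i.d.}\sim\sigma,$$ where $\sigma$ is the uniform probability measure on $\mathbb{S}^{n-1}$, $t_{n,N}:=\sqrt{1-\varepsilon_{n,N}^2}$ and $\varepsilon_{n,N}:=\left(\frac{(\ln 2)\,|\partial B_n|}{N|B_{n-1}|}\right)^{\frac1{n-1}}$. Then when $N$ is large enough, the random variable $|P_{n,N}\triangle B_n|$ satisfies, for any $\epsilon>0$, the concentration inequality $$\Pr_A\Big(\big||P_{n,N}\triangle B_n|-\mathbb{E}[|P_{n,N}\triangle B_n|]\big|\ge\epsilon\Big)\le 2\exp\left(-c(n)N^{1+\frac{4}{n-1}}f(N)\epsilon^2\right),$$ where $A$ is an event that holds with probability at least $1-\exp\left(-c_1(n)N^{0.5-\frac{2}{n-1}}\ln N\right)$, $c(n)$ and $c_1(n)$ are positive constants that depend only on the dimension, and $f(N)=(\ln N)^{-(2+\frac{4}{n-1})}$.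
   Context: $B_k$ is the Euclidean unit ball in $\mathbb{R}^k$ centered at the origin, $|B_k|$ its $k$-dimensional volume, $|\partial B_n|$ the surface area of $\mathbb{S}^{n-1}=\partial B_n$; $|\cdot|$ is $n$-dimensional volume for subsets of $\mathbb{R}^n$ such as $P_{n,N}\triangle B_n$, and $\triangle$ is symmetric difference. $\Pr_A$ denotes probability conditional on the event $A$, and $\mathbb{E}$ denotes expectation.
   Formalization: The expectation in the inequality is taken conditionally on A: the unconditional expectation of the volume of the symmetric difference is infinite, since with positive probability all X_i lie in an open half-space and the polytope is unbounded with infinite volume. *)

theory Defs
  imports "HOL-Probability.Probability"
begin

text \<open>
  Surface measure of the unit sphere via polar coordinates: the measure of a Borel set \<open>E\<close> is
  \<open>n\<close> times the volume of the cone \<open>{r u | 0 < r \<le> 1, u \<in> E \<inter> sphere 0 1}\<close>. It is a Borel measure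
  on the whole space, concentrated on the sphere (\<open>sgn x\<close> is \<open>x / norm x\<close>, and \<open>sgn 0 = 0\<close> only
  affects a null set).
\<close>

definition surface_measure :: "(real ^ 'n) measure" where
  "surface_measure =
     scale_measure (of_nat CARD('n)) (distr (restrict_space lborel (cball 0 1)) borel sgn)"

definition sphere_area :: "'n::finite itself \<Rightarrow> real" where
  "sphere_area _ = measure (surface_measure :: (real ^ 'n) measure) (sphere 0 1)"

definition sphere_uniform :: "(real ^ 'n) measure" where
  "sphere_uniform = uniform_measure surface_measure (sphere 0 1)"

lemma emeasure_surface_measure_sphere:
  "emeasure (surface_measure :: (real ^ 'n) measure) (sphere 0 1) =
     of_nat CARD('n) * ennreal (unit_ball_vol (real CARD('n)))"
proof -
  let ?R = "restrict_space lborel (cball 0 1) :: (real ^ 'n) measure"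
  have m: "sgn \<in> measurable ?R borel"
    by (intro measurable_restrict_space1) (simp add: sgn_div_norm)
  have eq: "sgn -` sphere 0 1 \<inter> cball 0 1 = cball 0 1 - {0 :: real ^ 'n}"
    by (auto simp: norm_sgn split: if_splits)
  have "emeasure (distr ?R borel sgn) (sphere 0 1) = emeasure ?R (cball 0 1 - {0})"
    by (subst emeasure_distr[OF m]) (simp_all add: space_restrict_space eq)
  also have "\<dots> = emeasure lborel (cball 0 1 - {0 :: real ^ 'n})"
    by (rule emeasure_restrict_space) auto
  also have "\<dots> = emeasure lborel (cball 0 1 :: (real ^ 'n) set)"
    by (subst emeasure_Diff) auto
  also have "\<dots> = ennreal (unit_ball_vol (real CARD('n)))"
    by (simp add: emeasure_cball)
  finally show ?thesis
    by (simp add: surface_measure_def)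
qed

lemma sphere_area_eq: "sphere_area TYPE('n::finite) = CARD('n) * unit_ball_vol (CARD('n))"
  by (simp add: sphere_area_def measure_def emeasure_surface_measure_sphere
      enn2real_mult flip: ennreal_of_nat_eq_real_of_nat)

lemma prob_space_sphere_uniform: "prob_space (sphere_uniform :: (real ^ 'n) measure)"
  unfolding sphere_uniform_def
  by (rule prob_space_uniform_measure)
     (auto simp: emeasure_surface_measure_sphere ennreal_mult_eq_top_iff
       less_imp_neq[OF unit_ball_vol_pos, symmetric])

definition cap_eps :: "'n::finite itself \<Rightarrow> nat \<Rightarrow> real" where
  "cap_eps T N =
     (ln 2 * sphere_area T / (real N * unit_ball_vol (real CARD('n) - 1)))
       powr (1 / (real CARD('n) - 1))"

definition cap_height :: "'n::finite itself \<Rightarrow> nat \<Rightarrow> real" where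
  "cap_height T N = sqrt (1 - (cap_eps T N)\<^sup>2)"

definition polytope_of :: "nat \<Rightarrow> (nat \<Rightarrow> real ^ 'n) \<Rightarrow> (real ^ 'n) set" where
  "polytope_of N X = (\<Inter>i\<in>{1..N}. {x. X i \<bullet> x \<le> cap_height TYPE('n) N})"

definition ball_diff :: "nat \<Rightarrow> (nat \<Rightarrow> real ^ 'n) \<Rightarrow> (real ^ 'n) set" where
  "ball_diff N X = sym_diff (polytope_of N X) (cball 0 1)"

text \<open>
  The joint law of \<open>X\<^sub>1, \<dots>, X\<^sub>N\<close>: under it the coordinate projections are i.i.d. uniform on the sphere.
\<close>

definition iid_sphere :: "nat \<Rightarrow> (nat \<Rightarrow> real ^ 'n) measure" where
  "iid_sphere N = PiM {1..N} (\<lambda>_. sphere_uniform)"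

text \<open>
  The random polytope is unbounded with positive probability for every \<open>N\<close> (all \<open>X\<^sub>i\<close> may lie in
  an open half-space), so its symmetric difference with the ball has infinite unconditional
  expectation. Both the probability and the expectation in the concentration inequality
  are therefore taken under the conditional law given an event \<open>A\<close>, which is
  \<open>uniform_measure (iid_sphere N) A\<close>.
\<close>

definition cond_law :: "nat \<Rightarrow> (nat \<Rightarrow> real ^ 'n) set \<Rightarrow> (nat \<Rightarrow> real ^ 'n) measure" where
  "cond_law N A = uniform_measure (iid_sphere N) A"

end

theory Submission
  imports Defs "HOL-Real_Asymp.Real_Asymp"
begin

text \<open>
  Put \<open>m = n - 1\<close> and let \<open>r\<close> be the radius with \<open>r ^ m\<close> of order \<open>ln N / N\<close>. Intersecting
  \<open>P \<triangle> B\<close> with the ball of radius \<open>1 + (3 r)\<^sup>2\<close> gives a set which a single \<open>X\<^sub>i\<close> affects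
  only inside a cap of radius \<open>O(r)\<close> and height \<open>O(r\<^sup>2)\<close>, so changing one point alters its volume by at
  most \<open>O(r ^ (m + 2))\<close>. For this truncated volume the bounded differences inequality is already the
  claimed bound.

  The discarded part lies over directions that are far from every \<open>X\<^sub>i\<close>. Let
  \<open>b = m / (2 (m + 2))\<close> and let \<open>r' ^ m\<close> be of order \<open>N powr (b - 1)\<close>. Up to probability
  \<open>2 exp (- N powr b)\<close>, every direction is within \<open>O(r')\<close> of some \<open>X\<^sub>i\<close>, and the far directions are covered
  by \<open>O(N powr b / ln N)\<close> caps of radius \<open>2 r\<close>; they contribute \<open>O(N powr (b - 1) * r'\<^sup>2)\<close>, which is
  at most the scale of the fluctuations exactly because \<open>b (1 + 2 / m) = 1/2\<close>. As \<open>b\<close> exceeds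
  \<open>1/2 - 2 / m\<close>, this good event may serve as \<open>A\<close>.
\<close>

subsection \<open>Bounded differences\<close>

lemma integrable_bounded_prob:
  fixes f :: "'a \<Rightarrow> real"
  assumes "prob_space M" "f \<in> borel_measurable M" "\<And>x. x \<in> space M \<Longrightarrow> \<bar>f x\<bar> \<le> B"
  shows "integrable M f"
proof -
  interpret prob_space M by fact
  show ?thesis
    by (rule integrable_const_bound[where B = B]) (use assms in auto)
qed

text \<open>Relative to one fixed point \<open>z\<close>, all values of \<open>f\<close> lie in an
  interval of length \<open>2 * c\<close> around \<open>f z\<close>. Hoeffding's lemma with this
  length gives the exponent \<open>l\<^sup>2 * (2 * c)\<^sup>2 / 8\<close>.\<close>

lemma mgf_interval_bound:
  fixes f :: "'a \<Rightarrow> real"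
  assumes "prob_space M" and meas: "f \<in> borel_measurable M" and "l > 0"
    and diff: "\<And>y z. y \<in> space M \<Longrightarrow> z \<in> space M \<Longrightarrow> \<bar>f y - f z\<bar> \<le> c"
  shows "(\<integral>y. exp (l * f y) \<partial>M) \<le> exp (l\<^sup>2 * c\<^sup>2 / 2) * exp (l * (\<integral>y. f y \<partial>M))"
proof -
  interpret prob_space M by fact
  obtain z where z: "z \<in> space M" using not_empty by auto
  let ?m = "\<integral>y. f y \<partial>M"
  interpret interval_bounded_random_variable M f "f z - c" "f z + c"
  proof
    show "AE x in M. f x \<in> {f z - c..f z + c}"
      using diff[OF _ z] by (intro AE_I2) (force simp: abs_le_iff)
  qed (rule meas)
  have "l\<^sup>2 * (f z + c - (f z - c))\<^sup>2 / 8 = l\<^sup>2 * c\<^sup>2 / 2"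
    by (simp add: power2_eq_square)
  then have nn: "nn_integral M (\<lambda>y. ennreal (exp (l * (f y - ?m)))) \<le> ennreal (exp (l\<^sup>2 * c\<^sup>2 / 2))"
    using Hoeffdings_lemma_nn_integral[OF \<open>l > 0\<close>] by (simp only:)
  have "f y \<le> f z + c" if "y \<in> space M" for y
    using diff[OF that z] by (simp add: abs_le_iff)
  then have int: "integrable M (\<lambda>y. exp (l * (f y - ?m)))"
    using \<open>l > 0\<close> meas
    by (intro integrable_bounded_prob[where B = "exp (l * (f z + c - ?m))"])
       (auto simp: prob_space_axioms)
  have "ennreal (\<integral>y. exp (l * (f y - ?m)) \<partial>M) \<le> ennreal (exp (l\<^sup>2 * c\<^sup>2 / 2))"
    using nn int by (subst nn_integral_eq_integral[symmetric]) auto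
  then have "(\<integral>y. exp (l * (f y - ?m)) \<partial>M) \<le> exp (l\<^sup>2 * c\<^sup>2 / 2)"
    by simp
  then have "(\<integral>y. exp (l * (f y - ?m)) \<partial>M) * exp (l * ?m) \<le> exp (l\<^sup>2 * c\<^sup>2 / 2) * exp (l * ?m)"
    by (intro mult_right_mono) auto
  also have "(\<integral>y. exp (l * (f y - ?m)) \<partial>M) * exp (l * ?m) = (\<integral>y. exp (l * f y) \<partial>M)"
    by (subst integral_mult_left_zero[symmetric])
       (simp add: exp_add[symmetric] algebra_simps)
  finally show ?thesis .
qed

text \<open>McDiarmid's inequality at the level of moment generating functions, by induction on the
  set of coordinates. Fubini integrates one coordinate out, which costs a factor
  \<open>exp (l\<^sup>2 * c\<^sup>2 / 2)\<close> by the one-variable bound.\<close>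

theorem bounded_differences_mgf:
  fixes f :: "('i \<Rightarrow> 'a) \<Rightarrow> real"
  assumes M: "prob_space M" and fin: "finite I" and "l > 0"
    and "f \<in> borel_measurable (PiM I (\<lambda>_. M))"
    and "\<And>x. x \<in> space (PiM I (\<lambda>_. M)) \<Longrightarrow> \<bar>f x\<bar> \<le> B"
    and "\<And>x i y. x \<in> space (PiM I (\<lambda>_. M)) \<Longrightarrow> i \<in> I \<Longrightarrow> y \<in> space M \<Longrightarrow>
           \<bar>f (x(i := y)) - f x\<bar> \<le> c"
  shows "(\<integral>x. exp (l * f x) \<partial>PiM I (\<lambda>_. M))
           \<le> exp (real (card I) * (l\<^sup>2 * c\<^sup>2 / 2)) * exp (l * (\<integral>x. f x \<partial>PiM I (\<lambda>_. M)))"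
  using fin assms(4-6)
proof (induction I arbitrary: f rule: finite_induct)
  case empty
  have "(\<integral>x. exp (l * f x) \<partial>PiM {} (\<lambda>_. M)) = exp (l * f (\<lambda>_. undefined))"
    by (simp add: PiM_empty lebesgue_integral_count_space_finite)
  moreover have "(\<integral>x. f x \<partial>PiM {} (\<lambda>_. M)) = f (\<lambda>_. undefined)"
    by (simp add: PiM_empty lebesgue_integral_count_space_finite)
  ultimately show ?case by simp
next
  case (insert i I)
  interpret M: prob_space M by fact
  interpret product_sigma_finite "\<lambda>_. M"
    by (rule product_sigma_finite.intro) (rule M.sigma_finite_measure_axioms)
  let ?P = "\<lambda>J. PiM J (\<lambda>_. M)"
  interpret PI: prob_space "?P I" by (rule prob_space_PiM) (rule M)
  interpret PiI: prob_space "?P (insert i I)" by (rule prob_space_PiM) (rule M)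
  note [measurable] = insert.prems(1)
  \<comment> \<open>This is the conditional expectation of \<open>f\<close> given the coordinates in
    \<open>I\<close>. Averaging preserves both the bound \<open>B\<close> and the difference bound
    \<open>c\<close>, so the induction hypothesis applies to it.\<close>
  define g where "g x = (\<integral>y. f (x(i := y)) \<partial>M)" for x
  have upd: "x(i := y) \<in> space (?P (insert i I))" if "x \<in> space (?P I)" "y \<in> space M" for x y
    using that by (auto simp: space_PiM PiE_iff extensional_def)
  have meas_upd: "(\<lambda>y. f (x(i := y))) \<in> borel_measurable M" if "x \<in> space (?P I)" for x
    using measurable_compose[OF measurable_component_update[OF that insert.hyps(2)] insert.prems(1)] .
  have int_upd: "integrable M (\<lambda>y. f (x(i := y)))" if "x \<in> space (?P I)" for x
    by (rule integrable_bounded_prob[where B = B, OF M meas_upd[OF that]])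
       (use insert.prems(2) upd that in auto)
  have [measurable]: "g \<in> borel_measurable (?P I)"
  proof -
    have "(\<lambda>(x, y). f (x(i := y))) \<in> borel_measurable (?P I \<Otimes>\<^sub>M M)"
      using measurable_compose[OF measurable_add_dim insert.prems(1)] by (simp add: split_beta)
    then show ?thesis unfolding g_def by (rule M.borel_measurable_lebesgue_integral)
  qed
  have g_bd: "\<bar>g x\<bar> \<le> B" if "x \<in> space (?P I)" for x
  proof -
    have "\<bar>g x\<bar> \<le> (\<integral>y. \<bar>f (x(i := y))\<bar> \<partial>M)" unfolding g_def by (rule integral_abs_bound)
    also have "\<dots> \<le> (\<integral>y. B \<partial>M)"
      using int_upd[OF that] insert.prems(2) upd that by (intro integral_mono) auto
    finally show ?thesis by (simp add: M.prob_space)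
  qed
  have g_diff: "\<bar>g (x(j := z)) - g x\<bar> \<le> c" if x: "x \<in> space (?P I)" and "j \<in> I" "z \<in> space M" for x j z
  proof -
    have x': "x(j := z) \<in> space (?P I)" using that by (auto simp: space_PiM PiE_iff extensional_def)
    have ij: "i \<noteq> j" using that insert.hyps by auto
    have "g (x(j := z)) - g x = (\<integral>y. f ((x(j := z))(i := y)) - f (x(i := y)) \<partial>M)"
      unfolding g_def by (rule Bochner_Integration.integral_diff[symmetric]) (intro int_upd x x')+
    also have "\<bar>\<dots>\<bar> \<le> (\<integral>y. \<bar>f ((x(j := z))(i := y)) - f (x(i := y))\<bar> \<partial>M)" by (rule integral_abs_bound)
    also have "\<dots> \<le> (\<integral>y. c \<partial>M)"
    proof (intro integral_mono integrable_abs Bochner_Integration.integrable_diff int_upd x x')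
      fix y assume "y \<in> space M"
      \<comment> \<open>Interchanging the two updates turns this into a change of the single
        coordinate \<open>j\<close> at the point \<open>x(i := y)\<close>.\<close>
      then show "\<bar>f ((x(j := z))(i := y)) - f (x(i := y))\<bar> \<le> c"
        unfolding fun_upd_twist[OF ij[symmetric]]
        by (intro insert.prems(3) upd x) (use that in auto)
    qed auto
    finally show ?thesis by (simp add: M.prob_space)
  qed
  have f_int: "integrable (?P (insert i I)) f"
    by (rule integrable_bounded_prob[where B = B]) (use insert.prems PiI.prob_space_axioms in auto)
  have exp_bd: "exp (l * a) \<le> exp (l * B)" if "\<bar>a\<bar> \<le> B" for a
    using that \<open>l > 0\<close> by (auto simp: abs_le_iff)
  have ef_int: "integrable (?P (insert i I)) (\<lambda>x. exp (l * f x))"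
    by (rule integrable_bounded_prob[where B = "exp (l * B)"])
       (use insert.prems exp_bd PiI.prob_space_axioms in auto)
  have eg_int: "integrable (?P I) (\<lambda>x. exp (l * g x))"
    by (rule integrable_bounded_prob[where B = "exp (l * B)"])
       (use g_bd exp_bd PI.prob_space_axioms in auto)
  have "(\<integral>x. exp (l * f x) \<partial>?P (insert i I)) = (\<integral>x. (\<integral>y. exp (l * f (x(i := y))) \<partial>M) \<partial>?P I)"
    by (rule product_integral_insert[OF insert.hyps ef_int])
  also have "\<dots> \<le> (\<integral>x. exp (l\<^sup>2 * c\<^sup>2 / 2) * exp (l * g x) \<partial>?P I)"
  proof (rule integral_mono')
    show "integrable (?P I) (\<lambda>x. exp (l\<^sup>2 * c\<^sup>2 / 2) * exp (l * g x))" using eg_int by simp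
  next
    fix x assume x: "x \<in> space (?P I)"
    show "(\<integral>y. exp (l * f (x(i := y))) \<partial>M) \<le> exp (l\<^sup>2 * c\<^sup>2 / 2) * exp (l * g x)"
      unfolding g_def
    proof (rule mgf_interval_bound[OF M meas_upd[OF x] \<open>l > 0\<close>])
      fix y z assume y: "y \<in> space M" and z: "z \<in> space M"
      show "\<bar>f (x(i := y)) - f (x(i := z))\<bar> \<le> c"
        using insert.prems(3)[OF upd[OF x z] insertI1 y] by (simp only: fun_upd_upd)
    qed
  qed auto
  also have "\<dots> = exp (l\<^sup>2 * c\<^sup>2 / 2) * (\<integral>x. exp (l * g x) \<partial>?P I)" by simp
  also have "\<dots> \<le> exp (l\<^sup>2 * c\<^sup>2 / 2) *
      (exp (real (card I) * (l\<^sup>2 * c\<^sup>2 / 2)) * exp (l * (\<integral>x. g x \<partial>?P I)))"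
    by (intro mult_left_mono insert.IH g_bd g_diff) auto
  also have "(\<integral>x. g x \<partial>?P I) = (\<integral>x. f x \<partial>?P (insert i I))"
    unfolding g_def by (rule product_integral_insert[OF insert.hyps f_int, symmetric])
  finally show ?case
    using insert.hyps by (simp add: exp_add[symmetric] algebra_simps add_divide_distrib)
qed

subsection \<open>Volumes of cones over small caps\<close>

text \<open>Up to the origin, a null set, only the trace of \<open>E\<close> on the unit sphere
  matters. At radius 1 the volume of the cone is proportional to the surface measure of that trace,
  so estimates on the sphere reduce to volumes in the whole space.\<close>

definition radial_cone :: "real \<Rightarrow> 'a::euclidean_space set \<Rightarrow> 'a set" where
  "radial_cone \<rho> E = {x \<in> cball 0 \<rho>. sgn x \<in> E}"

lemma sgn_borel [measurable]: "(sgn :: 'a::euclidean_space \<Rightarrow> 'a) \<in> borel_measurable borel"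
  by (simp add: sgn_div_norm)

lemma cone_borel [measurable]:
  assumes [measurable]: "E \<in> sets borel" shows "radial_cone \<rho> E \<in> sets borel"
  unfolding radial_cone_def by measurable

lemma cball_fmeasurable [simp]: "cball (c :: 'a::euclidean_space) r \<in> fmeasurable lborel"
  by (intro fmeasurableI emeasure_lborel_cball_finite) auto

lemma fmeasurable_bounded_borel:
  fixes S :: "'a::euclidean_space set"
  assumes "S \<in> sets borel" "S \<subseteq> cball 0 r"
  shows "S \<in> fmeasurable lborel"
  by (intro fmeasurableI2[of "cball 0 r" lborel S]) (use assms in auto)

lemma cone_fmeasurable: "E \<in> sets borel \<Longrightarrow> radial_cone \<rho> E \<in> fmeasurable lborel"
  by (rule fmeasurable_bounded_borel[where r = \<rho>]) (auto simp: radial_cone_def intro: cone_borel[unfolded radial_cone_def])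

text \<open>A dilation leaves directions unchanged, so the cone is an affine image of the unit cone.
  The scaling rule is applied to \<open>lebesgue\<close> and carried back to \<open>lborel\<close>
  through completion.\<close>

lemma measure_cone_scale:
  fixes E :: "'a::euclidean_space set"
  assumes "E \<in> sets borel" "\<rho> > 0"
  shows "measure lborel (radial_cone \<rho> E) = \<rho> ^ DIM('a) * measure lborel (radial_cone 1 E)"
proof -
  have eq: "radial_cone \<rho> E = (\<lambda>x. \<rho> *\<^sub>R x + 0) ` radial_cone 1 E"
  proof (intro equalityI subsetI)
    fix x assume "x \<in> radial_cone \<rho> E"
    then have "(1 / \<rho>) *\<^sub>R x \<in> radial_cone 1 E" "x = \<rho> *\<^sub>R ((1 / \<rho>) *\<^sub>R x) + 0"
      using assms(2) by (auto simp: radial_cone_def sgn_scaleR divide_simps)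
    then show "x \<in> (\<lambda>x. \<rho> *\<^sub>R x + 0) ` radial_cone 1 E" by blast
  qed (use assms(2) in \<open>auto simp: radial_cone_def sgn_scaleR\<close>)
  have "measure lebesgue (radial_cone \<rho> E) = \<rho> ^ DIM('a) * measure lebesgue (radial_cone 1 E)"
    unfolding eq using measure_lebesgue_affine[of \<rho> 0 "radial_cone 1 E"] assms(2) by simp
  then show ?thesis using assms(1) by (simp add: measure_completion cone_borel)
qed

text \<open>A crude Lipschitz bound for the power function on \<open>[0, 2]\<close>, the range of
  all radii that occur later.\<close>

lemma power_diff_le:
  fixes a b :: real
  assumes "0 \<le> a" "a \<le> b" "b \<le> 2"
  shows "b ^ n - a ^ n \<le> real n * 2 ^ n * (b - a)"
proof (cases n)
  case (Suc k)
  have "b ^ n - a ^ n = (b - a) * (\<Sum>i<n. b ^ i * a ^ (n - Suc i))"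
    by (simp add: power_diff_sumr2 mult.commute)
  also have "\<dots> \<le> (b - a) * (\<Sum>i<n. 2 ^ n)"
  proof (intro mult_left_mono sum_mono)
    fix i assume i: "i \<in> {..<n}"
    have "b ^ i * a ^ (n - Suc i) \<le> 2 ^ i * 2 ^ (n - Suc i)"
      using assms by (intro mult_mono power_mono) auto
    also have "\<dots> = 2 ^ (n - 1)" using i by (simp flip: power_add)
    also have "\<dots> \<le> 2 ^ n" by (rule power_increasing) auto
    finally show "b ^ i * a ^ (n - Suc i) \<le> 2 ^ n" .
  qed (use assms in auto)
  finally show ?thesis by (simp add: mult_ac)
qed simp

lemma measure_cone_shell_le:
  fixes E :: "'a::euclidean_space set"
  assumes E: "E \<in> sets borel" and ab: "0 < a" "a \<le> b" "b \<le> 2"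
  shows "measure lborel (radial_cone b E - radial_cone a E)
    \<le> real DIM('a) * 2 ^ DIM('a) * (b - a) * measure lborel (radial_cone 1 E)"
proof -
  have "measure lborel (radial_cone b E - radial_cone a E) = measure lborel (radial_cone b E) - measure lborel (radial_cone a E)"
    using ab E by (intro measurable_measure_Diff cone_fmeasurable) (auto simp: radial_cone_def intro: cone_borel[unfolded radial_cone_def])
  also have "\<dots> = (b ^ DIM('a) - a ^ DIM('a)) * measure lborel (radial_cone 1 E)"
    using measure_cone_scale[OF E, of a] measure_cone_scale[OF E, of b] ab by (simp add: algebra_simps)
  also have "\<dots> \<le> real DIM('a) * 2 ^ DIM('a) * (b - a) * measure lborel (radial_cone 1 E)"
    using ab by (intro mult_right_mono power_diff_le) auto
  finally show ?thesis .
qed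

section \<open>Radial projection and two-sided volume bounds for narrow cones\<close>

text \<open>Radial projection is Lipschitz away from the origin. This keeps small balls centred on
  the axis of a cone inside the cone.\<close>

lemma norm_sgn_diff_le:
  fixes x y :: "'a::real_normed_vector"
  assumes "y \<noteq> 0"
  shows "norm (sgn x - sgn y) \<le> 2 * norm (x - y) / norm y"
proof -
  have "norm y * norm (sgn x - sgn y) = norm (norm y *\<^sub>R sgn x - y)"
  proof -
    have "norm y *\<^sub>R (sgn x - sgn y) = norm y *\<^sub>R sgn x - y"
      using assms by (simp add: sgn_div_norm scaleR_diff_right)
    then show ?thesis by (metis norm_scaleR abs_norm_cancel)
  qed
  also have "norm y *\<^sub>R sgn x - y = (norm y - norm x) *\<^sub>R sgn x + (x - y)"
    by (cases "x = 0") (simp_all add: sgn_div_norm algebra_simps)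
  also have "norm \<dots> \<le> \<bar>norm y - norm x\<bar> * norm (sgn x) + norm (x - y)"
    by (rule norm_triangle_le) simp
  also have "\<dots> \<le> \<bar>norm y - norm x\<bar> * 1 + norm (x - y)"
    by (intro add_mono mult_left_mono) (auto simp: norm_sgn)
  also have "\<dots> \<le> 2 * norm (x - y)"
    using norm_triangle_ineq3[of y x] by (simp add: norm_minus_commute)
  finally show ?thesis using assms by (simp add: field_simps)
qed

text \<open>The cone is covered by about \<open>1 / r\<close> balls of radius \<open>2 * r\<close>
  strung along its axis. Each has volume of order \<open>r ^ DIM('a)\<close>, which leaves the
  exponent \<open>DIM('a) - 1\<close>.\<close>

lemma measure_cone_cball_le:
  fixes p :: "'a::euclidean_space"
  assumes p: "norm p = 1" and r: "0 < r" "r \<le> 1"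
  shows "measure lborel (radial_cone 1 (cball p r)) \<le>
    2 ^ (DIM('a) + 1) * unit_ball_vol (real DIM('a)) * r ^ (DIM('a) - 1)"
proof -
  define K where "K = nat \<lfloor>1 / r\<rfloor>"
  have cover: "radial_cone 1 (cball p r) \<subseteq> (\<Union>j\<in>{0..K}. cball ((real j * r) *\<^sub>R p) (2 * r))"
  proof
    fix x assume "x \<in> radial_cone 1 (cball p r)"
    then have x: "norm x \<le> 1" "norm (sgn x - p) \<le> r"
      by (auto simp: radial_cone_def dist_norm norm_minus_commute)
    define j where "j = nat \<lfloor>norm x / r\<rfloor>"
    have j1: "real j \<le> norm x / r" unfolding j_def using r by simp
    have j2: "norm x / r < real j + 1" unfolding j_def using r by linarith
    have "norm x / r \<le> 1 / r" using x r by (simp add: divide_right_mono)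
    then have "j \<le> K" unfolding j_def K_def by (intro nat_mono floor_mono)
    \<comment> \<open>The first summand is the angular error and the second the radial error
      relative to the chosen centre; each is at most \<open>r\<close>.\<close>
    have "x - (real j * r) *\<^sub>R p = norm x *\<^sub>R (sgn x - p) + (norm x - real j * r) *\<^sub>R p"
      by (cases "x = 0") (simp_all add: sgn_div_norm algebra_simps)
    also have "norm \<dots> \<le> norm x * norm (sgn x - p) + \<bar>norm x - real j * r\<bar> * norm p"
      by (rule norm_triangle_le) simp
    also have "\<dots> \<le> 1 * r + r"
    proof (intro add_mono mult_mono)
      have "real j * r \<le> norm x" "norm x < (real j + 1) * r"
        using j1 j2 r by (simp_all add: field_simps)
      then show "\<bar>norm x - real j * r\<bar> * norm p \<le> r" using p by (simp add: algebra_simps)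
    qed (use x in auto)
    finally have "x \<in> cball ((real j * r) *\<^sub>R p) (2 * r)"
      by (simp add: dist_norm norm_minus_commute)
    then show "x \<in> (\<Union>j\<in>{0..K}. cball ((real j * r) *\<^sub>R p) (2 * r))" using \<open>j \<le> K\<close> by auto
  qed
  let ?w = "unit_ball_vol (real DIM('a))"
  have "measure lborel (radial_cone 1 (cball p r)) \<le>
      measure lborel (\<Union>j\<in>{0..K}. cball ((real j * r) *\<^sub>R p) (2 * r))"
  proof (rule measure_mono_fmeasurable[OF cover])
    show "(\<Union>j\<in>{0..K}. cball ((real j * r) *\<^sub>R p) (2 * r)) \<in> fmeasurable lborel"
      by (intro fmeasurable.finite_UN) auto
  qed (auto intro: cone_borel)
  also have "\<dots> \<le> (\<Sum>j\<in>{0..K}. measure lborel (cball ((real j * r) *\<^sub>R p) (2 * r)))"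
    by (rule measure_UNION_le) auto
  also have "\<dots> = (real K + 1) * (?w * (2 * r) ^ DIM('a))"
    using r by (simp add: content_cball)
  also have "\<dots> \<le> (2 / r) * (?w * (2 * r) ^ DIM('a))"
  proof (rule mult_right_mono)
    have "real K \<le> 1 / r" unfolding K_def using r by simp
    also have "1 \<le> 1 / r" using r by simp
    ultimately show "real K + 1 \<le> 2 / r" using r by (simp add: field_simps)
  qed (use r in auto)
  also have "\<dots> = 2 ^ (DIM('a) + 1) * ?w * r ^ (DIM('a) - 1)"
    using r by (cases "DIM('a)") (simp_all add: field_simps power_mult_distrib)
  finally show ?thesis .
qed

text \<open>The counterpart by packing: of order \<open>1 / r\<close> disjoint balls with centres on
  the outer half of the axis fit into the cone.\<close>

lemma measure_cone_ball_ge: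
  fixes p :: "'a::euclidean_space"
  assumes p: "norm p = 1" and r: "0 < r" "r \<le> 1"
  shows "unit_ball_vol (real DIM('a)) * (1 / 8) * (1 / 5) ^ (DIM('a) - 1) * r ^ (DIM('a) - 1)
    \<le> measure lborel (radial_cone 1 (ball p r))"
proof -
  let ?w = "unit_ball_vol (real DIM('a))"
  \<comment> \<open>At a centre of norm at least \<open>1 / 2\<close>, radial projection enlarges
    distances by a factor of at most 4, and \<open>4 * d < r\<close>.\<close>
  define d where "d = r / 5"
  have d: "0 < d" "d \<le> 1 / 5" using r by (auto simp: d_def)
  define K where "K = nat \<lfloor>1 / (4 * d)\<rfloor>"
  \<comment> \<open>Centres start at height \<open>1 / 2\<close> and are \<open>2 * d\<close> apart,
    so the balls of radius \<open>d\<close> are disjoint; \<open>K\<close> is such that the last one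
    still lies in the unit ball.\<close>
  define s where "s j = 1 / 2 + 2 * d * real j" for j :: nat
  define B where "B j = ball (s j *\<^sub>R p) d" for j
  have K1: "real K \<le> 1 / (4 * d)" unfolding K_def using d by simp
  have K2: "1 / (4 * d) < real K + 1" unfolding K_def using d by linarith
  \<comment> \<open>As \<open>K\<close> is at least 1, rounding down loses no more than a factor of
    2.\<close>
  have K3: "1 / (8 * d) \<le> real K"
  proof -
    have "1 \<le> 1 / (4 * d)" using d by (simp add: field_simps)
    then have "1 \<le> K" unfolding K_def by linarith
    then show ?thesis using K2 by (simp add: field_simps)
  qed
  have sub: "B j \<subseteq> radial_cone 1 (ball p r)" if "j < K" for j
  proof
    fix x assume "x \<in> B j"
    then have x: "norm (x - s j *\<^sub>R p) < d" by (simp add: B_def dist_norm norm_minus_commute)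
    have sj: "1 / 2 \<le> s j" using d by (simp add: s_def)
    have "real j + 1 \<le> real K" using that by simp
    then have "2 * d * (real j + 1) \<le> 2 * d * (1 / (4 * d))"
      using K1 d by (intro mult_left_mono) auto
    then have "s j + d \<le> 1" using d by (simp add: s_def algebra_simps)
    moreover have "norm x \<le> norm (x - s j *\<^sub>R p) + norm (s j *\<^sub>R p)" using norm_triangle_sub[of x "s j *\<^sub>R p"] by simp
    ultimately have "norm x \<le> 1" using x p sj by simp
    have "s j *\<^sub>R p \<noteq> 0" using sj p by auto
    from norm_sgn_diff_le[OF this, of x]
    have "norm (sgn x - p) \<le> 2 * norm (x - s j *\<^sub>R p) / s j"
      using sj p by (simp add: sgn_scaleR sgn_div_norm)
    also have "\<dots> \<le> 2 * d / (1 / 2)" using x sj d by (intro frac_le mult_left_mono) auto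
    also have "\<dots> < r" using r by (simp add: d_def)
    finally show "x \<in> radial_cone 1 (ball p r)"
      using \<open>norm x \<le> 1\<close> by (simp add: radial_cone_def dist_norm norm_minus_commute)
  qed
  have disj: "disjoint_family_on B {..<K}"
  proof -
    have "B i \<inter> B j = {}" if "i < j" for i j
    proof -
      have "dist (s i *\<^sub>R p) (s j *\<^sub>R p) = \<bar>s i - s j\<bar>"
        using p by (simp add: dist_norm flip: scaleR_diff_left)
      also have "\<dots> = 2 * d * (real j - real i)" using that d by (simp add: s_def algebra_simps)
      also have "\<dots> \<ge> 2 * d * 1" using that d by (intro mult_left_mono) auto
      finally show ?thesis unfolding B_def by (intro disjoint_ballI) simp
    qed
    then show ?thesis unfolding disjoint_family_on_def by (metis Int_commute linorder_neqE_nat)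
  qed
  have "?w * (1 / 8) * (1 / 5) ^ (DIM('a) - 1) * r ^ (DIM('a) - 1) = (1 / (8 * d)) * (?w * d ^ DIM('a))"
    using r by (cases "DIM('a)") (simp_all add: field_simps d_def)
  also have "\<dots> \<le> real K * (?w * d ^ DIM('a))"
    using K3 d by (intro mult_right_mono) auto
  also have "\<dots> = (\<Sum>j<K. measure lborel (B j))"
    using d by (simp add: B_def content_ball)
  also have "\<dots> = measure lborel (\<Union>j<K. B j)"
    using disj emeasure_lborel_ball_finite unfolding B_def
    by (intro measure_finite_Union[symmetric]) (auto simp: less_top)
  also have "\<dots> \<le> measure lborel (radial_cone 1 (ball p r))"
    by (rule measure_mono_fmeasurable) (use sub cone_fmeasurable[of "ball p r"] in \<open>auto simp: B_def\<close>)
  finally show ?thesis .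
qed

subsection \<open>Nets on the sphere and empty balls\<close>

text \<open>The factor left in the lower bound for a cone over a ball of radius \<open>r\<close>
  after division by the volume of the unit ball and by \<open>r ^ (CARD('n) - 1)\<close>.\<close>

definition cap_const :: "'n::finite itself \<Rightarrow> real" where
  "cap_const _ = (1 / 8) * (1 / 5) ^ (CARD('n) - 1)"

lemma cap_const_pos: "cap_const TYPE('n::finite) > 0"
  by (simp add: cap_const_def)

lemma sets_sphere_uniform [simp, measurable_cong]: "sets (sphere_uniform :: (real ^ 'n) measure) = sets borel"
  by (simp add: sphere_uniform_def surface_measure_def)

lemma space_sphere_uniform [simp]: "space (sphere_uniform :: (real ^ 'n) measure) = UNIV"
  using sets_eq_imp_space_eq[OF sets_sphere_uniform] by simp

text \<open>The factor \<open>CARD('n)\<close> in the surface measure cancels on normalising, so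
  probabilities on the sphere are ratios of cone volumes.\<close>

lemma measure_sphere_uniform:
  fixes E :: "(real ^ 'n) set"
  assumes [measurable]: "E \<in> sets borel"
  shows "measure sphere_uniform E
    = measure lborel (radial_cone 1 (sphere 0 1 \<inter> E)) / unit_ball_vol (real CARD('n))"
proof -
  let ?R = "restrict_space lborel (cball 0 1) :: (real ^ 'n) measure"
  let ?A = "sphere 0 1 :: (real ^ 'n) set"
  have m: "sgn \<in> measurable ?R borel" by (intro measurable_restrict_space1) simp
  have "emeasure (distr ?R borel sgn) (?A \<inter> E) = emeasure ?R (radial_cone 1 (?A \<inter> E))"
    by (subst emeasure_distr[OF m])
       (auto simp: space_restrict_space radial_cone_def intro!: arg_cong[where f = "emeasure ?R"])
  also have "\<dots> = emeasure lborel (radial_cone 1 (?A \<inter> E))"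
    by (rule emeasure_restrict_space) (auto simp: radial_cone_def)
  finally have 1: "measure (surface_measure :: (real ^ 'n) measure) (?A \<inter> E)
      = real CARD('n) * measure lborel (radial_cone 1 (?A \<inter> E))"
    by (simp add: surface_measure_def measure_def enn2real_mult flip: ennreal_of_nat_eq_real_of_nat)
  have 2: "measure (surface_measure :: (real ^ 'n) measure) ?A = real CARD('n) * unit_ball_vol (real CARD('n))"
    using sphere_area_eq[where 'n = 'n] by (simp add: sphere_area_def)
  have "emeasure (surface_measure :: (real ^ 'n) measure) ?A \<noteq> 0"
    "emeasure (surface_measure :: (real ^ 'n) measure) ?A \<noteq> \<infinity>"
    by (auto simp: emeasure_surface_measure_sphere ennreal_mult_eq_top_iff
       less_imp_neq[OF unit_ball_vol_pos, symmetric])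
  then have "measure sphere_uniform E = measure (surface_measure :: (real ^ 'n) measure) (?A \<inter> E)
      / measure (surface_measure :: (real ^ 'n) measure) ?A"
    unfolding sphere_uniform_def by (rule measure_uniform_measure) (simp add: surface_measure_def)
  then show ?thesis unfolding 1 2 by simp
qed

lemma AE_sphere_uniform: "AE x in (sphere_uniform :: (real ^ 'n) measure). x \<in> sphere 0 1"
  unfolding sphere_uniform_def by (rule AE_uniform_measureI) (simp_all add: surface_measure_def)

lemma measure_sphere_uniform_ball_ge:
  fixes p :: "real ^ 'n"
  assumes p: "p \<in> sphere 0 1" and r: "0 < r" "r \<le> 1"
  shows "cap_const TYPE('n) * r ^ (CARD('n) - 1) \<le> measure sphere_uniform (ball p r)"
proof -
  let ?w = "unit_ball_vol (real CARD('n))"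
  have "radial_cone 1 (sphere 0 1 \<inter> ball p r) = radial_cone 1 (ball p r)"
    using p r by (auto simp: radial_cone_def norm_sgn dist_norm split: if_splits)
  then have "measure sphere_uniform (ball p r) = measure lborel (radial_cone 1 (ball p r)) / ?w"
    by (simp add: measure_sphere_uniform)
  also have "\<dots> \<ge> (?w * (1 / 8) * (1 / 5) ^ (CARD('n) - 1) * r ^ (CARD('n) - 1)) / ?w"
    using measure_cone_ball_ge[of p r] p r by (intro divide_right_mono) (auto simp: less_imp_le)
  finally show ?thesis by (simp add: cap_const_def less_imp_neq[OF unit_ball_vol_pos, symmetric])
qed

text \<open>The separation \<open>2 * r\<close> is what makes the open balls of radius
  \<open>r\<close> around the points disjoint.\<close>

definition packing :: "real \<Rightarrow> 'a::metric_space set \<Rightarrow> bool" where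
  "packing r T \<longleftrightarrow> finite T \<and> (\<forall>p\<in>T. \<forall>q\<in>T. p \<noteq> q \<longrightarrow> 2 * r \<le> dist p q)"

lemma packing_subset: "packing r T \<Longrightarrow> J \<subseteq> T \<Longrightarrow> packing r J"
  unfolding packing_def by (meson finite_subset subsetD)

lemma measure_packing_ge:
  fixes T :: "(real ^ 'n) set"
  assumes T: "packing r T" "T \<subseteq> sphere 0 1" and r: "0 < r" "r \<le> 1"
  shows "real (card T) * (cap_const TYPE('n) * r ^ (CARD('n) - 1)) \<le> measure sphere_uniform (\<Union>p\<in>T. ball p r)"
proof -
  interpret prob_space "sphere_uniform :: (real ^ 'n) measure" by (rule prob_space_sphere_uniform)
  have "real (card T) * (cap_const TYPE('n) * r ^ (CARD('n) - 1)) = (\<Sum>p\<in>T. cap_const TYPE('n) * r ^ (CARD('n) - 1))"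
    by simp
  also have "\<dots> \<le> (\<Sum>p\<in>T. prob (ball p r))"
    using T r by (intro sum_mono measure_sphere_uniform_ball_ge) auto
  also have "\<dots> = prob (\<Union>p\<in>T. ball p r)"
  proof (rule finite_measure_finite_Union[symmetric])
    show "disjoint_family_on (\<lambda>p. ball p r) T"
      using T unfolding disjoint_family_on_def packing_def by (auto intro!: disjoint_ballI)
  qed (use T in \<open>auto simp: packing_def\<close>)
  finally show ?thesis .
qed

text \<open>A packing of maximal cardinality is a net, since a point at distance at least
  \<open>2 * r\<close> from all its members could be added. The maximum exists because disjoint
  balls of probability at least \<open>cap_const TYPE('n) * r ^ (CARD('n) - 1)\<close> number at
  most the reciprocal of that.\<close>

lemma sphere_net_exists:
  assumes r: "0 < r" "r \<le> 1"
  shows "\<exists>T :: (real ^ 'n) set. packing r T \<and> T \<subseteq> sphere 0 1 \<and> (\<forall>u\<in>sphere 0 1. \<exists>p\<in>T. dist u p < 2 * r) \<and>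
    real (card T) * (cap_const TYPE('n) * r ^ (CARD('n) - 1)) \<le> 1"
proof -
  interpret prob_space "sphere_uniform :: (real ^ 'n) measure" by (rule prob_space_sphere_uniform)
  let ?k = "cap_const TYPE('n) * r ^ (CARD('n) - 1)"
  let ?P = "\<lambda>T :: (real ^ 'n) set. packing r T \<and> T \<subseteq> sphere 0 1"
  have k: "?k > 0" using r cap_const_pos[where 'n = 'n] by simp
  have bd: "real (card T) * ?k \<le> 1" if "?P T" for T
    using measure_packing_ge[of r T] that r prob_le_1[of "\<Union>p\<in>T. ball p r"] by linarith
  have "card T \<le> nat \<lceil>1 / ?k\<rceil>" if "?P T" for T
  proof -
    have "real (card T) \<le> 1 / ?k" using bd[OF that] k by (simp add: pos_le_divide_eq)
    then show ?thesis by linarith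
  qed
  moreover have "?P {}" by (simp add: packing_def)
  ultimately obtain T where T: "?P T" and max: "\<And>T'. ?P T' \<Longrightarrow> card T' \<le> card T"
    using ex_has_greatest_nat[of ?P "{}" card "Suc (nat \<lceil>1 / ?k\<rceil>)"] by (metis (mono_tags, lifting) le_imp_less_Suc)
  have "\<exists>p\<in>T. dist u p < 2 * r" if u: "u \<in> sphere 0 1" for u
  proof (rule ccontr)
    assume *: "\<not> ?thesis"
    then have "?P (insert u T)"
      using T u unfolding packing_def by (auto simp: dist_commute not_less)
    moreover have "u \<notin> T" using * r by force
    ultimately show False using max[of "insert u T"] T by (simp add: packing_def)
  qed
  then show ?thesis using T bd by blast
qed

section \<open>Probability that balls contain no sample point\<close>

lemma prob_space_iid_sphere: "prob_space (iid_sphere N :: (nat \<Rightarrow> real ^ 'n) measure)"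
  unfolding iid_sphere_def by (intro prob_space_PiM prob_space_sphere_uniform)

definition misses :: "nat \<Rightarrow> (nat \<Rightarrow> 'a) \<Rightarrow> 'a set \<Rightarrow> bool" where
  "misses N X B \<longleftrightarrow> (\<forall>i\<in>{1..N}. X i \<notin> B)"

lemma sets_misses [measurable]:
  fixes B :: "(real ^ 'n) set"
  assumes "B \<in> sets borel"
  shows "{X \<in> space (iid_sphere N). misses N X B} \<in> sets (iid_sphere N)"
proof -
  have [measurable]: "B \<in> sets sphere_uniform" using assms by simp
  show ?thesis unfolding iid_sphere_def misses_def by measurable
qed

text \<open>By independence the probability is the \<open>N\<close>-th power of
  \<open>1 - measure sphere_uniform B\<close>, and \<open>1 - s \<le> exp (- s)\<close>.\<close>

lemma prob_misses_le:
  fixes B :: "(real ^ 'n) set"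
  assumes "B \<in> sets borel"
  shows "measure (iid_sphere N) {X \<in> space (iid_sphere N). misses N X B}
    \<le> exp (- real N * measure sphere_uniform B)"
proof -
  interpret S: prob_space "sphere_uniform :: (real ^ 'n) measure" by (rule prob_space_sphere_uniform)
  interpret finite_product_prob_space "\<lambda>_. sphere_uniform :: (real ^ 'n) measure" "{1..N}"
    by unfold_locales auto
  have "measure (iid_sphere N) (\<Pi>\<^sub>E i\<in>{1..N}. - B) = measure sphere_uniform (- B) ^ N"
    unfolding iid_sphere_def using assms by (subst prob_times) auto
  moreover have "{X \<in> space (iid_sphere N). misses N X B} = (\<Pi>\<^sub>E i\<in>{1..N}. - B)"
    by (auto simp: iid_sphere_def space_PiM misses_def PiE_iff extensional_def)
  ultimately have "measure (iid_sphere N) {X \<in> space (iid_sphere N). misses N X B}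
      = measure sphere_uniform (- B) ^ N" by (simp only:)
  also have "measure sphere_uniform (- B) = 1 - measure sphere_uniform B"
    using S.prob_compl[of B] assms by (simp add: Compl_eq_Diff_UNIV)
  also have "(1 - measure sphere_uniform B) ^ N \<le> exp (- measure sphere_uniform B) ^ N"
    using exp_ge_add_one_self[of "- measure sphere_uniform B"] by (intro power_mono) auto
  also have "\<dots> = exp (- real N * measure sphere_uniform B)"
    by (simp flip: exp_of_nat_mult)
  finally show ?thesis .
qed

definition empty_balls :: "nat \<Rightarrow> real \<Rightarrow> 'a::metric_space set \<Rightarrow> (nat \<Rightarrow> 'a) \<Rightarrow> 'a set" where
  "empty_balls N r T X = {p \<in> T. misses N X (ball p r)}"

lemma card_empty_balls_measurable [measurable]:
  fixes T :: "(real ^ 'n) set"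
  assumes "finite T"
  shows "(\<lambda>X. card (empty_balls N r T X)) \<in> measurable (iid_sphere N) (count_space UNIV)"
proof -
  have "card (empty_balls N r T X) = (\<Sum>p\<in>T. if misses N X (ball p r) then 1 else 0)" for X
    using assms by (simp add: empty_balls_def sum.If_cases Int_def)
  moreover have "Measurable.pred (iid_sphere N) (\<lambda>X. misses N X (ball p r))" for p :: "real ^ 'n"
    unfolding pred_def by (rule sets_misses) auto
  ultimately show ?thesis by simp
qed

text \<open>A union bound over the \<open>k\<close>-element subsets \<open>J\<close> of
  \<open>T\<close>. All balls of \<open>J\<close> being empty means that the sample misses their
  union, whose measure is at least \<open>k\<close> times the bound for one ball because they are
  disjoint. In this way the dependence between different balls causes no loss.\<close>

lemma prob_empty_balls_ge:
  fixes T :: "(real ^ 'n) set"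
  assumes T: "packing r T" "T \<subseteq> sphere 0 1" and r: "0 < r" "r \<le> 1"
  shows "measure (iid_sphere N) {X \<in> space (iid_sphere N). k \<le> card (empty_balls N r T X)}
    \<le> real (card T) ^ k * exp (- real N * (real k * (cap_const TYPE('n) * r ^ (CARD('n) - 1))))"
proof -
  interpret prob_space "iid_sphere N :: (nat \<Rightarrow> real ^ 'n) measure" by (rule prob_space_iid_sphere)
  let ?J = "{J. J \<subseteq> T \<and> card J = k}"
  let ?E = "\<lambda>J. {X \<in> space (iid_sphere N). misses N X (\<Union>p\<in>J. ball p r)}"
  have fin: "finite T" using T by (simp add: packing_def)
  have finJ: "finite ?J" by (rule finite_subset[of _ "Pow T"]) (use fin in auto)
  have E_sets: "?E J \<in> sets (iid_sphere N)" for J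
    by (intro sets_misses borel_open open_UN) auto
  have "{X \<in> space (iid_sphere N). k \<le> card (empty_balls N r T X)} \<subseteq> (\<Union>J\<in>?J. ?E J)"
  proof
    fix X assume X: "X \<in> {X \<in> space (iid_sphere N). k \<le> card (empty_balls N r T X)}"
    then obtain J where "J \<subseteq> empty_balls N r T X" "card J = k"
      using obtain_subset_with_card_n by (metis (mono_tags, lifting) mem_Collect_eq)
    then show "X \<in> (\<Union>J\<in>?J. ?E J)"
      using X by (auto simp: empty_balls_def misses_def)
  qed
  then have "prob {X \<in> space (iid_sphere N). k \<le> card (empty_balls N r T X)} \<le> prob (\<Union>J\<in>?J. ?E J)"
    using finJ by (intro finite_measure_mono sets.finite_UN E_sets) auto
  also have "\<dots> \<le> (\<Sum>J\<in>?J. prob (?E J))"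
    using finJ by (intro finite_measure_subadditive_finite) (use E_sets in auto)
  also have "\<dots> \<le> (\<Sum>J\<in>?J. exp (- real N * (real k * (cap_const TYPE('n) * r ^ (CARD('n) - 1)))))"
  proof (rule sum_mono)
    fix J assume J: "J \<in> ?J"
    have "prob (?E J) \<le> exp (- real N * measure sphere_uniform (\<Union>p\<in>J. ball p r))"
      by (intro prob_misses_le borel_open open_UN) auto
    also have "real k * (cap_const TYPE('n) * r ^ (CARD('n) - 1)) \<le> measure sphere_uniform (\<Union>p\<in>J. ball p r)"
      using measure_packing_ge[of r J] packing_subset[OF T(1), of J] J T r by auto
    then have "exp (- real N * measure sphere_uniform (\<Union>p\<in>J. ball p r))
        \<le> exp (- real N * (real k * (cap_const TYPE('n) * r ^ (CARD('n) - 1))))"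
      by (simp add: mult_left_mono)
    finally show "prob (?E J) \<le> exp (- real N * (real k * (cap_const TYPE('n) * r ^ (CARD('n) - 1))))" .
  qed
  also have "\<dots> = real (card T choose k) * exp (- real N * (real k * (cap_const TYPE('n) * r ^ (CARD('n) - 1))))"
    by (simp add: n_subsets[OF fin])
  also have "\<dots> \<le> real (card T) ^ k * exp (- real N * (real k * (cap_const TYPE('n) * r ^ (CARD('n) - 1))))"
  proof (rule mult_right_mono)
    show "real (card T choose k) \<le> real (card T) ^ k"
      by (cases "k \<le> card T") (simp_all add: binomial_le_pow binomial_eq_0 flip: of_nat_power)
  qed simp
  finally show ?thesis .
qed

subsection \<open>Geometry of the polytope\<close>

lemma measure_diff_le_of_sym_diff:
  assumes A: "A \<in> fmeasurable M" and B: "B \<in> fmeasurable M" and C: "C \<in> fmeasurable M"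
    and sub: "sym_diff A B \<subseteq> C"
  shows "\<bar>measure M A - measure M B\<bar> \<le> measure M C"
proof -
  have "measure M A \<le> measure M (B \<union> C)" "measure M B \<le> measure M (A \<union> C)"
    using sub A B C by (auto intro!: measure_mono_fmeasurable fmeasurable.Un)
  moreover have "measure M (B \<union> C) \<le> measure M B + measure M C" "measure M (A \<union> C) \<le> measure M A + measure M C"
    using A B C by (auto intro!: measure_Un_le)
  ultimately show ?thesis by linarith
qed

lemma dist_unit_sq:
  fixes u v :: "'a::real_inner"
  assumes "norm u = 1" "norm v = 1"
  shows "(dist u v)\<^sup>2 = 2 - 2 * (u \<bullet> v)"
proof -
  have "(dist u v)\<^sup>2 = (u - v) \<bullet> (u - v)" by (simp add: dist_norm power2_norm_eq_inner)
  also have "\<dots> = u \<bullet> u + v \<bullet> v - 2 * (u \<bullet> v)" by (simp add: inner_diff inner_commute)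
  moreover have "u \<bullet> u = 1" "v \<bullet> v = 1" using assms by (simp_all flip: power2_norm_eq_inner)
  ultimately show ?thesis by simp
qed

lemma inner_unit_eq:
  fixes p x :: "'a::real_inner"
  shows "p \<bullet> x = norm x * (p \<bullet> sgn x)"
  by (cases "x = 0") (simp_all add: sgn_div_norm)

text \<open>A point of the cap has \<open>p \<bullet> sgn x \<ge> t / \<rho>\<close>, so its
  direction is within \<open>h\<close> of \<open>p\<close> by the identity for distances of unit
  vectors. Its norm exceeds \<open>t\<close>, so the cap lies in a shell of thickness
  \<open>\<rho> - t\<close> over a narrow cone.\<close>

lemma measure_cap_le:
  fixes p :: "'a::euclidean_space"
  assumes p: "norm p = 1" and t: "0 < t" "t \<le> \<rho>" "\<rho> \<le> 2"
    and h: "0 < h" "h \<le> 1" "2 - 2 * t / \<rho> \<le> h\<^sup>2"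
  shows "measure lborel {x \<in> cball 0 \<rho>. p \<bullet> x > t} \<le>
    real DIM('a) * 2 ^ DIM('a) * (\<rho> - t) * (2 ^ (DIM('a) + 1) * unit_ball_vol (real DIM('a)) * h ^ (DIM('a) - 1))"
proof -
  have "{x \<in> cball 0 \<rho>. p \<bullet> x > t} \<subseteq> radial_cone \<rho> (cball p h) - radial_cone t (cball p h)"
  proof
    fix x assume "x \<in> {x \<in> cball 0 \<rho>. p \<bullet> x > t}"
    then have x: "norm x \<le> \<rho>" "p \<bullet> x > t" by auto
    have nx: "p \<bullet> x \<le> norm x" using norm_cauchy_schwarz[of p x] p by simp
    then have "norm x > 0" using x t by linarith
    then have "norm (sgn x) = 1" by (simp add: norm_sgn)
    then have "(dist p (sgn x))\<^sup>2 = 2 - 2 * (p \<bullet> sgn x)" using p by (simp add: dist_unit_sq)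
    also have "\<dots> \<le> 2 - 2 * t / \<rho>"
    proof -
      have "t / \<rho> \<le> t / norm x" using x \<open>norm x > 0\<close> t by (intro divide_left_mono) auto
      also have "\<dots> \<le> p \<bullet> sgn x"
        using x \<open>norm x > 0\<close> inner_unit_eq[of p x] by (simp add: divide_le_eq mult.commute)
      finally show ?thesis by simp
    qed
    also have "\<dots> \<le> h\<^sup>2" by (rule h)
    finally have "dist p (sgn x) \<le> h" using h by (simp add: power2_le_iff_abs_le)
    then show "x \<in> radial_cone \<rho> (cball p h) - radial_cone t (cball p h)"
      using x nx by (auto simp: radial_cone_def)
  qed
  then have "measure lborel {x \<in> cball 0 \<rho>. p \<bullet> x > t} \<le>
      measure lborel (radial_cone \<rho> (cball p h) - radial_cone t (cball p h))"
    by (rule measure_mono_fmeasurable) (auto intro!: fmeasurable_Diff cone_fmeasurable cone_borel)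
  also have "\<dots> \<le> real DIM('a) * 2 ^ DIM('a) * (\<rho> - t) * measure lborel (radial_cone 1 (cball p h))"
    using t by (intro measure_cone_shell_le) auto
  also have "\<dots> \<le> real DIM('a) * 2 ^ DIM('a) * (\<rho> - t) *
      (2 ^ (DIM('a) + 1) * unit_ball_vol (real DIM('a)) * h ^ (DIM('a) - 1))"
    using t h p by (intro mult_left_mono measure_cone_cball_le) auto
  finally show ?thesis .
qed

lemma cap_height_le_1: "cap_height T N \<le> 1"
  by (simp add: cap_height_def)

lemma closed_polytope_of: "closed (polytope_of N X)"
  unfolding polytope_of_def by (intro closed_INT ballI closed_halfspace_le)

lemma ball_diff_borel [measurable]: "ball_diff N X \<in> sets borel"
  unfolding ball_diff_def using closed_polytope_of[of N X] by (auto intro: borel_closed)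

text \<open>Outside the two caps cut off by \<open>X i\<close> and \<open>Y i\<close> both
  constraints with index \<open>i\<close> hold, so the two polytopes agree there. Truncation at
  radius \<open>\<rho>\<close> makes these caps small.\<close>

lemma ball_diff_Int_change_one:
  fixes X Y :: "nat \<Rightarrow> real ^ 'n"
  assumes X: "norm (X i) = 1" and Y: "norm (Y i) = 1" and eq: "\<And>j. j \<noteq> i \<Longrightarrow> X j = Y j"
    and t: "0 < cap_height TYPE('n) N" "1 \<le> \<rho>" "\<rho> \<le> 2"
    and h: "0 < h" "h \<le> 1" "2 - 2 * cap_height TYPE('n) N / \<rho> \<le> h\<^sup>2"
  shows "\<bar>measure lborel (ball_diff N X \<inter> cball 0 \<rho>) - measure lborel (ball_diff N Y \<inter> cball 0 \<rho>)\<bar>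
    \<le> 2 * (real CARD('n) * 2 ^ CARD('n) * (\<rho> - cap_height TYPE('n) N) *
        (2 ^ (CARD('n) + 1) * unit_ball_vol (real CARD('n)) * h ^ (CARD('n) - 1)))"
proof -
  let ?t = "cap_height TYPE('n) N"
  define C where "C p = {x \<in> cball 0 \<rho>. p \<bullet> x > ?t}" for p :: "real ^ 'n"
  have [measurable]: "C p \<in> sets borel" for p unfolding C_def by measurable
  have C: "C p \<in> fmeasurable lborel" for p
    by (rule fmeasurable_bounded_borel[where r = \<rho>]) (simp, simp add: C_def subset_eq)
  have bd: "measure lborel (C p) \<le> real CARD('n) * 2 ^ CARD('n) * (\<rho> - ?t) *
        (2 ^ (CARD('n) + 1) * unit_ball_vol (real CARD('n)) * h ^ (CARD('n) - 1))" if "norm p = 1" for p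
    using measure_cap_le[OF that, of ?t \<rho> h] t h cap_height_le_1[of "TYPE('n)" N] by (simp add: C_def)
  have D: "ball_diff N Z \<inter> cball 0 \<rho> \<in> fmeasurable lborel" for Z :: "nat \<Rightarrow> real ^ 'n"
    by (rule fmeasurable_bounded_borel[where r = \<rho>]) auto
  have "\<bar>measure lborel (ball_diff N X \<inter> cball 0 \<rho>) - measure lborel (ball_diff N Y \<inter> cball 0 \<rho>)\<bar>
      \<le> measure lborel (C (X i) \<union> C (Y i))"
  proof (rule measure_diff_le_of_sym_diff[OF D D fmeasurable.Un[OF C C]])
    have "x \<in> C (X i) \<union> C (Y i)" if x: "norm x \<le> \<rho>" "x \<in> polytope_of N X \<longleftrightarrow> x \<notin> polytope_of N Y" for x
    proof (rule ccontr)
      assume "x \<notin> C (X i) \<union> C (Y i)"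
      then have "X i \<bullet> x \<le> ?t" "Y i \<bullet> x \<le> ?t" using x by (auto simp: C_def)
      then have "X j \<bullet> x \<le> ?t \<longleftrightarrow> Y j \<bullet> x \<le> ?t" for j using eq[of j] by (cases "j = i") auto
      then have "x \<in> polytope_of N X \<longleftrightarrow> x \<in> polytope_of N Y" by (simp add: polytope_of_def)
      then show False using x by blast
    qed
    moreover have "norm x \<le> \<rho> \<and> (x \<in> polytope_of N X \<longleftrightarrow> x \<notin> polytope_of N Y)"
      if "x \<in> sym_diff (ball_diff N X \<inter> cball 0 \<rho>) (ball_diff N Y \<inter> cball 0 \<rho>)" for x
      using that by (auto simp: ball_diff_def)
    ultimately show "sym_diff (ball_diff N X \<inter> cball 0 \<rho>) (ball_diff N Y \<inter> cball 0 \<rho>) \<subseteq> C (X i) \<union> C (Y i)"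
      by blast
  qed
  also have "\<dots> \<le> measure lborel (C (X i)) + measure lborel (C (Y i))"
    by (rule measure_Un_le) auto
  finally show ?thesis using bd[OF X] bd[OF Y] by linarith
qed

section \<open>Far points of the polytope lie over empty balls\<close>

text \<open>The constraint of a nearby \<open>X i\<close> gives
  \<open>norm x * (1 - h\<^sup>2 / 2) \<le> 1\<close>. Passing to \<open>1 + h\<^sup>2\<close>
  amounts to \<open>h\<^sup>2 * h\<^sup>2 \<le> h\<^sup>2\<close>, which is where
  \<open>h \<le> 1\<close> enters.\<close>

lemma norm_polytope_le_of_near:
  fixes X :: "nat \<Rightarrow> real ^ 'n"
  assumes x: "x \<in> polytope_of N X" and i: "i \<in> {1..N}" "norm (X i) = 1"
    and d: "dist (X i) (sgn x) \<le> h" "h \<le> 1"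
  shows "norm x \<le> 1 + h\<^sup>2"
proof (cases "x = 0")
  case False
  have "h \<ge> 0" using d zero_le_dist[of "X i" "sgn x"] by linarith
  have "(dist (X i) (sgn x))\<^sup>2 = 2 - 2 * (X i \<bullet> sgn x)"
    using False i by (intro dist_unit_sq) (auto simp: norm_sgn)
  moreover have "(dist (X i) (sgn x))\<^sup>2 \<le> h\<^sup>2" using d by (intro power_mono) auto
  ultimately have "1 - h\<^sup>2 / 2 \<le> X i \<bullet> sgn x" by simp
  then have "norm x * (1 - h\<^sup>2 / 2) \<le> X i \<bullet> x"
    unfolding inner_unit_eq[of "X i" x] by (intro mult_left_mono) auto
  also have "\<dots> \<le> 1" using x i cap_height_le_1[of "TYPE('n)" N] by (force simp: polytope_of_def)
  also have "1 \<le> (1 + h\<^sup>2) * (1 - h\<^sup>2 / 2)"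
  proof -
    have "h\<^sup>2 \<le> 1" using d \<open>h \<ge> 0\<close> by (simp add: power_le_one)
    then have "h\<^sup>2 * h\<^sup>2 \<le> h\<^sup>2 * 1" by (intro mult_left_mono) auto
    then show ?thesis by (simp add: algebra_simps)
  qed
  finally have "norm x * (1 - h\<^sup>2 / 2) \<le> (1 + h\<^sup>2) * (1 - h\<^sup>2 / 2)" .
  moreover have "1 - h\<^sup>2 / 2 > 0" using d \<open>h \<ge> 0\<close> power_le_one[of h 2] by simp
  ultimately show ?thesis by simp
qed simp

definition spherical_net :: "real \<Rightarrow> 'a::real_normed_vector set \<Rightarrow> bool" where
  "spherical_net r T \<longleftrightarrow> (\<forall>u\<in>sphere 0 1. \<exists>p\<in>T. dist u p < 2 * r)"

text \<open>A net point \<open>p\<close> lies within \<open>2 * r\<close> of the direction of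
  \<open>x\<close>. A sample point in \<open>ball p r\<close> would then be within
  \<open>3 * r\<close> of that direction and keep \<open>x\<close> inside the radius
  \<open>1 + (3 * r)\<^sup>2\<close>.\<close>

lemma polytope_of_far_point:
  fixes X :: "nat \<Rightarrow> real ^ 'n"
  assumes T: "spherical_net r T" and r: "0 < r" "3 * r \<le> 1"
    and X: "\<And>i. i \<in> {1..N} \<Longrightarrow> norm (X i) = 1"
    and x: "x \<in> polytope_of N X" "norm x > 1 + (3 * r)\<^sup>2"
  shows "\<exists>p\<in>empty_balls N r T X. dist p (sgn x) < 2 * r"
proof -
  have "norm x > 0" using x(2) by (smt (verit) zero_le_power2)
  then have "sgn x \<in> sphere 0 1" by (simp add: norm_sgn)
  then obtain p where p: "p \<in> T" "dist (sgn x) p < 2 * r" 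
    using T unfolding spherical_net_def by blast
  have "X i \<notin> ball p r" if i: "i \<in> {1..N}" for i
  proof
    assume "X i \<in> ball p r"
    then have "dist (X i) (sgn x) \<le> 3 * r"
      using p dist_triangle[of "X i" "sgn x" p] by (simp add: dist_commute)
    then have "norm x \<le> 1 + (3 * r)\<^sup>2"
      by (rule norm_polytope_le_of_near[OF x(1) i X[OF i] _ r(2)])
    then show False using x by simp
  qed
  then show ?thesis using p by (auto simp: empty_balls_def misses_def dist_commute)
qed

text \<open>Two scales cooperate. The net at scale \<open>r'\<close> has no empty ball, so the whole
  polytope stays within \<open>1 + (3 * r')\<^sup>2\<close>; the net at scale \<open>r\<close> has
  at most \<open>k\<close> empty balls, and everything beyond \<open>\<rho>\<close> lies over their
  caps of radius \<open>2 * r\<close>. The discarded volume is thus at most that of \<open>k\<close>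
  thin shells.\<close>

lemma ball_diff_outer_part:
  fixes X :: "nat \<Rightarrow> real ^ 'n"
  assumes T: "spherical_net r T" "finite T" "T \<subseteq> sphere 0 1" and r: "0 < r" "3 * r \<le> 1"
    and T': "spherical_net r' T'" and r': "0 < r'" "3 * r' \<le> 1"
    and X: "\<And>i. i \<in> {1..N} \<Longrightarrow> norm (X i) = 1"
    and none: "empty_balls N r' T' X = {}" and few: "card (empty_balls N r T X) \<le> k"
  defines "\<rho> \<equiv> 1 + (3 * r)\<^sup>2"
  shows "ball_diff N X \<subseteq> cball 0 2"
    and "\<bar>measure lborel (ball_diff N X) - measure lborel (ball_diff N X \<inter> cball 0 \<rho>)\<bar>
      \<le> real k * (real CARD('n) * 2 ^ CARD('n) * (3 * r')\<^sup>2 *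
          (2 ^ (CARD('n) + 1) * unit_ball_vol (real CARD('n)) * (2 * r) ^ (CARD('n) - 1)))"
proof -
  let ?\<rho> = "1 + (3 * r')\<^sup>2"
  have "(3 * r')\<^sup>2 \<le> 1" by (rule power_le_one) (use r' in auto)
  then have \<rho>': "?\<rho> \<le> 2" by linarith
  have P: "polytope_of N X \<subseteq> cball 0 ?\<rho>"
  proof (rule subsetI, rule ccontr)
    fix x assume x: "x \<in> polytope_of N X" and "x \<notin> cball 0 ?\<rho>"
    then have "norm x > ?\<rho>" by simp
    from polytope_of_far_point[OF T' r'(1) r'(2) X x this] show False using none by simp
  qed
  moreover have "cball 0 1 \<subseteq> (cball 0 ?\<rho> :: (real ^ 'n) set)" by (rule subset_cball) simp
  ultimately have bd: "ball_diff N X \<subseteq> cball 0 ?\<rho>" by (auto simp: ball_diff_def)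
  also have "\<dots> \<subseteq> cball 0 2" using \<rho>' by (rule subset_cball)
  finally show sub2: "ball_diff N X \<subseteq> cball 0 2" .
  let ?E = "empty_balls N r T X"
  let ?S = "\<lambda>p. radial_cone ?\<rho> (cball p (2 * r)) - radial_cone 1 (cball p (2 * r))"
  have finE: "finite ?E" using T by (simp add: empty_balls_def)
  have S: "?S p \<in> fmeasurable lborel" for p :: "real ^ 'n"
    by (intro fmeasurable_Diff cone_fmeasurable) (auto intro: cone_borel)
  have "\<bar>measure lborel (ball_diff N X) - measure lborel (ball_diff N X \<inter> cball 0 \<rho>)\<bar>
      \<le> measure lborel (\<Union>p\<in>?E. ?S p)"
  proof (rule measure_diff_le_of_sym_diff)
    show "ball_diff N X \<in> fmeasurable lborel" by (rule fmeasurable_bounded_borel[OF _ sub2]) simp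
    show "ball_diff N X \<inter> cball 0 \<rho> \<in> fmeasurable lborel"
      by (rule fmeasurable_bounded_borel[where r = \<rho>]) auto
    show "(\<Union>p\<in>?E. ?S p) \<in> fmeasurable lborel" using finE S by (intro fmeasurable.finite_UN) auto
    \<comment> \<open>Since \<open>\<rho> \<ge> 1\<close>, a point of the symmetric difference
      beyond \<open>\<rho>\<close> is outside the ball and hence belongs to the polytope.\<close>
    have outer: "x \<in> (\<Union>p\<in>?E. ?S p)" if x: "x \<in> ball_diff N X" "norm x > \<rho>" for x
    proof -
      have "1 \<le> \<rho>" by (simp add: \<rho>_def)
      then have "x \<in> polytope_of N X" using x by (auto simp: ball_diff_def)
      moreover have "norm x > 1 + (3 * r)\<^sup>2" using x by (simp add: \<rho>_def)
      ultimately obtain p where "p \<in> ?E" "dist p (sgn x) < 2 * r"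
        using polytope_of_far_point[where N = N and X = X, OF T(1) r(1) r(2) X] by blast
      moreover have "norm x \<le> ?\<rho>" using bd x by auto
      ultimately show ?thesis using x \<open>1 \<le> \<rho>\<close> by (auto simp: radial_cone_def intro!: bexI[of _ p])
    qed
    show "sym_diff (ball_diff N X) (ball_diff N X \<inter> cball 0 \<rho>) \<subseteq> (\<Union>p\<in>?E. ?S p)"
      by (rule subsetI, rule outer) auto
  qed
  also have "\<dots> \<le> (\<Sum>p\<in>?E. measure lborel (?S p))"
    using finE S by (intro measure_UNION_le) auto
  also have "\<dots> \<le> (\<Sum>p\<in>?E. real CARD('n) * 2 ^ CARD('n) * (3 * r')\<^sup>2 *
          (2 ^ (CARD('n) + 1) * unit_ball_vol (real CARD('n)) * (2 * r) ^ (CARD('n) - 1)))"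
  proof (rule sum_mono)
    fix p assume "p \<in> ?E"
    then have p: "norm p = 1" using T by (auto simp: empty_balls_def)
    have "measure lborel (?S p) \<le> real CARD('n) * 2 ^ CARD('n) * (3 * r')\<^sup>2 * measure lborel (radial_cone 1 (cball p (2 * r)))"
      using measure_cone_shell_le[of "cball p (2 * r)" 1 ?\<rho>] \<rho>' by simp
    also have "\<dots> \<le> real CARD('n) * 2 ^ CARD('n) * (3 * r')\<^sup>2 *
          (2 ^ (CARD('n) + 1) * unit_ball_vol (real CARD('n)) * (2 * r) ^ (CARD('n) - 1))"
      using measure_cone_cball_le[OF p, of "2 * r"] r by (intro mult_left_mono) auto
    finally show "measure lborel (?S p) \<le> real CARD('n) * 2 ^ CARD('n) * (3 * r')\<^sup>2 *
          (2 ^ (CARD('n) + 1) * unit_ball_vol (real CARD('n)) * (2 * r) ^ (CARD('n) - 1))" .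
  qed
  also have "\<dots> \<le> real k * (real CARD('n) * 2 ^ CARD('n) * (3 * r')\<^sup>2 *
          (2 ^ (CARD('n) + 1) * unit_ball_vol (real CARD('n)) * (2 * r) ^ (CARD('n) - 1)))"
    using few r by (simp add: mult_right_mono)
  finally show "\<bar>measure lborel (ball_diff N X) - measure lborel (ball_diff N X \<inter> cball 0 \<rho>)\<bar> \<le> \<dots>" .
qed

text \<open>The volume is the measure of a section of a measurable set in the product of the sample
  space with \<open>lborel\<close>. The map \<open>\<phi>\<close> allows the same argument for the
  sample itself and for its retraction to the sphere.\<close>

lemma measure_ball_diff_measurable:
  fixes \<phi> :: "real ^ 'n \<Rightarrow> real ^ 'n"
  assumes [measurable]: "\<phi> \<in> borel_measurable borel" "S \<in> sets borel"
  shows "(\<lambda>X. measure lborel (ball_diff N (\<lambda>i. \<phi> (X i)) \<inter> S)) \<in> borel_measurable (iid_sphere N)"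
proof -
  let ?M = "iid_sphere N :: (nat \<Rightarrow> real ^ 'n) measure"
  let ?t = "cap_height TYPE('n) N"
  let ?Q = "{w \<in> space (?M \<Otimes>\<^sub>M lborel).
    ((\<forall>i\<in>{1..N}. \<phi> (fst w i) \<bullet> snd w \<le> ?t) \<longleftrightarrow> snd w \<notin> cball 0 1) \<and> snd w \<in> S}"
  have fst_i: "(\<lambda>w. fst w i) \<in> measurable (?M \<Otimes>\<^sub>M lborel) borel" if "i \<in> {1..N}" for i
  proof -
    have "(\<lambda>X. X i) \<in> measurable ?M sphere_uniform"
      unfolding iid_sphere_def using that by (rule measurable_component_singleton)
    then have "(\<lambda>X. X i) \<in> measurable ?M borel" by (simp cong: measurable_cong_sets)
    then show ?thesis by (rule measurable_compose[OF measurable_fst])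
  qed
  have [measurable]: "snd \<in> measurable (?M \<Otimes>\<^sub>M lborel) borel"
    using measurable_snd[of ?M lborel] by simp
  have [measurable]: "Measurable.pred (?M \<Otimes>\<^sub>M lborel) (\<lambda>w. \<forall>i\<in>{1..N}. \<phi> (fst w i) \<bullet> snd w \<le> ?t)"
  proof (intro pred_intros_finite)
    fix i assume "i \<in> {1..N}"
    note [measurable] = fst_i[OF this]
    show "Measurable.pred (?M \<Otimes>\<^sub>M lborel) (\<lambda>w. \<phi> (fst w i) \<bullet> snd w \<le> ?t)" by measurable
  qed simp
  have [measurable]: "cball 0 1 \<in> sets (borel :: (real ^ 'n) measure)" by simp
  have "?Q \<in> sets (?M \<Otimes>\<^sub>M lborel)" by measurable
  then have "(\<lambda>X. emeasure lborel (Pair X -` ?Q)) \<in> borel_measurable ?M"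
    by (rule lborel.measurable_emeasure_Pair)
  then have "(\<lambda>X. measure lborel (Pair X -` ?Q)) \<in> borel_measurable ?M"
    unfolding measure_def by measurable
  also have "?this \<longleftrightarrow> ?thesis"
  proof (intro measurable_cong)
    fix X assume "X \<in> space ?M"
    then have "Pair X -` ?Q = ball_diff N (\<lambda>i. \<phi> (X i)) \<inter> S"
      by (auto simp: space_pair_measure ball_diff_def polytope_of_def)
    then show "measure lborel (Pair X -` ?Q) = measure lborel (ball_diff N (\<lambda>i. \<phi> (X i)) \<inter> S)" by simp
  qed
  finally show ?thesis .
qed

subsection \<open>Sub-Gaussian variables under conditioning\<close>

text \<open>Conditioning on an event of probability at least \<open>1 / 2\<close> has density at
  most 2.\<close>

lemma integral_uniform_measure_le:
  fixes u :: "'a \<Rightarrow> real"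
  assumes M: "prob_space M" and A: "A \<in> sets M" "measure M A \<ge> 1 / 2"
    and u: "integrable M u" "\<And>x. 0 \<le> u x"
  shows "(\<integral>x. u x \<partial>uniform_measure M A) \<le> 2 * (\<integral>x. u x \<partial>M)"
proof -
  interpret prob_space M by fact
  have um [measurable]: "u \<in> borel_measurable M" using u(1) by simp
  have int: "(\<integral>\<^sup>+x. u x \<partial>M) = ennreal (\<integral>x. u x \<partial>M)"
    using u by (intro nn_integral_eq_integral) auto
  have pos: "0 \<le> (\<integral>x. u x \<partial>M)" using u(2) by simp
  have "(\<integral>\<^sup>+x. u x \<partial>uniform_measure M A) = (\<integral>\<^sup>+x. ennreal (u x) * indicator A x \<partial>M) / emeasure M A"
    using A by (intro nn_integral_uniform_measure) auto
  also have "\<dots> \<le> (\<integral>\<^sup>+x. u x \<partial>M) / emeasure M A"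
    by (intro divide_right_mono_ennreal nn_integral_mono) (auto split: split_indicator)
  also have "\<dots> = ennreal ((\<integral>x. u x \<partial>M) / measure M A)"
    using A pos unfolding int emeasure_eq_measure by (intro divide_ennreal) auto
  also have "\<dots> \<le> ennreal (2 * (\<integral>x. u x \<partial>M))"
  proof (rule ennreal_leI)
    have "(\<integral>x. u x \<partial>M) / measure M A \<le> (\<integral>x. u x \<partial>M) / (1 / 2)"
      using A pos by (intro divide_left_mono) auto
    then show "(\<integral>x. u x \<partial>M) / measure M A \<le> 2 * (\<integral>x. u x \<partial>M)" by simp
  qed
  finally have "enn2real (\<integral>\<^sup>+x. u x \<partial>uniform_measure M A) \<le> 2 * (\<integral>x. u x \<partial>M)"
    using pos by (intro enn2real_leI) auto
  moreover have "(\<integral>x. u x \<partial>uniform_measure M A) = enn2real (\<integral>\<^sup>+x. u x \<partial>uniform_measure M A)"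
    using u(2) by (intro integral_eq_nn_integral) (auto simp: uniform_measure_def)
  ultimately show ?thesis by simp
qed

text \<open>\<open>V\<close> is a variance proxy and \<open>m\<close> an explicit centre, so that
  the same centre can be kept after conditioning. Integrability is demanded because the integral of
  a non-integrable function is 0 by default and the bound would then say nothing.\<close>

definition subgaussian :: "'a measure \<Rightarrow> real \<Rightarrow> real \<Rightarrow> ('a \<Rightarrow> real) \<Rightarrow> bool" where
  "subgaussian M m V g \<longleftrightarrow> (\<forall>l. l \<noteq> 0 \<longrightarrow> integrable M (\<lambda>x. exp (l * (g x - m))) \<and>
     (\<integral>x. exp (l * (g x - m)) \<partial>M) \<le> exp (l\<^sup>2 * V / 2))"

lemma subgaussianD:
  assumes "subgaussian M m V g" "l \<noteq> 0"
  shows "integrable M (\<lambda>x. exp (l * (g x - m)))"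
    and "(\<integral>x. exp (l * (g x - m)) \<partial>M) \<le> exp (l\<^sup>2 * V / 2)"
  using assms unfolding subgaussian_def by blast+

text \<open>Chernoff's bound with the optimal parameter \<open>y / V\<close>; the sign
  \<open>s\<close> treats the upper and the lower tail at once.\<close>

lemma subgaussian_tail:
  assumes M: "prob_space M" and g: "subgaussian M m V g" "V > 0" and y: "y > 0"
    and [measurable]: "g \<in> borel_measurable M"
  shows "measure M {x \<in> space M. \<bar>g x - m\<bar> \<ge> y} \<le> 2 * exp (- y\<^sup>2 / (2 * V))"
proof -
  interpret prob_space M by fact
  have one: "prob {x \<in> space M. s * (g x - m) \<ge> y} \<le> exp (- y\<^sup>2 / (2 * V))" if s: "s\<^sup>2 = 1" for s
  proof -
    define l where "l = y / V"
    have l: "l > 0" using y g by (simp add: l_def)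
    have s0: "s \<noteq> 0" using s by auto
    have int: "integrable M (\<lambda>x. exp ((l * s) * (g x - m)))"
      and le: "(\<integral>x. exp ((l * s) * (g x - m)) \<partial>M) \<le> exp ((l * s)\<^sup>2 * V / 2)"
      using subgaussianD[OF g(1), of "l * s"] l s0 by auto
    have "{x \<in> space M. s * (g x - m) \<ge> y} = {x \<in> space M. exp ((l * s) * (g x - m)) \<ge> exp (l * y)}"
      using l by (auto simp: mult.assoc)
    then have "prob {x \<in> space M. s * (g x - m) \<ge> y} \<le> (\<integral>x. exp ((l * s) * (g x - m)) \<partial>M) / exp (l * y)"
      using integral_Markov_inequality_measure[OF int sets.empty_sets, of "exp (l * y)"] by simp
    also have "\<dots> \<le> exp ((l * s)\<^sup>2 * V / 2) / exp (l * y)"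
      by (intro divide_right_mono le) simp
    also have "\<dots> = exp ((l * s)\<^sup>2 * V / 2 - l * y)" by (simp add: exp_diff)
    also have "(l * s)\<^sup>2 * V / 2 - l * y = - y\<^sup>2 / (2 * V)"
      using g s by (simp add: l_def power_mult_distrib power2_eq_square field_simps)
    finally show ?thesis .
  qed
  have "{x \<in> space M. \<bar>g x - m\<bar> \<ge> y} = {x \<in> space M. 1 * (g x - m) \<ge> y} \<union> {x \<in> space M. (-1) * (g x - m) \<ge> y}"
    by auto
  then have "prob {x \<in> space M. \<bar>g x - m\<bar> \<ge> y}
      \<le> prob {x \<in> space M. 1 * (g x - m) \<ge> y} + prob {x \<in> space M. (-1) * (g x - m) \<ge> y}"
    by (simp only:) (intro measure_Un_le; measurable)
  with one[of 1] one[of "-1"] show ?thesis by simp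
qed

text \<open>Integrate \<open>\<bar>z\<bar> \<le> exp z + exp (- z)\<close> at
  \<open>z = (g x - m) / R\<close>, using the exponential moments at \<open>1 / R\<close> and
  \<open>- 1 / R\<close>.\<close>

lemma subgaussian_abs_mean:
  assumes M: "prob_space M" and g: "subgaussian M m V g" and R: "R > 0" "V \<le> a * R\<^sup>2"
    and int: "integrable M g"
  shows "(\<integral>x. \<bar>g x - m\<bar> \<partial>M) \<le> 2 * R * exp (a / 2)"
proof -
  interpret prob_space M by fact
  have R': "1 / R \<noteq> 0" "- 1 / R \<noteq> 0" using R by auto
  note int1 = subgaussianD(1)[OF g R'(1)] and le1 = subgaussianD(2)[OF g R'(1)]
  note int2 = subgaussianD(1)[OF g R'(2)] and le2 = subgaussianD(2)[OF g R'(2)]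
  have pt: "\<bar>g x - m\<bar> \<le> R * (exp ((1 / R) * (g x - m)) + exp ((- 1 / R) * (g x - m)))" for x
  proof -
    have "\<bar>z\<bar> \<le> exp z + exp (- z)" for z :: real
      using exp_ge_add_one_self[of z] exp_ge_add_one_self[of "- z"] exp_gt_zero[of z] exp_gt_zero[of "- z"]
      unfolding abs_le_iff by linarith
    from this[of "(g x - m) / R"] have "\<bar>(g x - m) / R\<bar> \<le> exp ((1 / R) * (g x - m)) + exp ((- 1 / R) * (g x - m))"
      by simp
    then show ?thesis using R by (simp add: abs_divide divide_le_eq mult.commute)
  qed
  have "(\<integral>x. \<bar>g x - m\<bar> \<partial>M) \<le> (\<integral>x. R * (exp ((1 / R) * (g x - m)) + exp ((- 1 / R) * (g x - m))) \<partial>M)"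
    using int int1 int2 pt by (intro integral_mono integrable_mult_right Bochner_Integration.integrable_add) auto
  also have "\<dots> = R * ((\<integral>x. exp ((1 / R) * (g x - m)) \<partial>M) + (\<integral>x. exp ((- 1 / R) * (g x - m)) \<partial>M))"
    using int1 int2 by simp
  also have "\<dots> \<le> R * (exp (a / 2) + exp (a / 2))"
  proof (intro mult_left_mono add_mono)
    have "V / R\<^sup>2 \<le> a" using R by (simp add: divide_le_eq)
    then have "(1 / R)\<^sup>2 * V / 2 \<le> a / 2" "(- 1 / R)\<^sup>2 * V / 2 \<le> a / 2" by (simp_all add: power_divide)
    then show "(\<integral>x. exp ((1 / R) * (g x - m)) \<partial>M) \<le> exp (a / 2)"
      "(\<integral>x. exp ((- 1 / R) * (g x - m)) \<partial>M) \<le> exp (a / 2)"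
      using le1 le2 by (meson exp_le_cancel_iff order_trans)+
  qed (use R in auto)
  finally show ?thesis by simp
qed

text \<open>The first term is half of the exponent in the tail bound at
  \<open>\<epsilon> / 2\<close>, the other half being spent on constants. The second makes the
  claimed bound trivial while \<open>\<epsilon>\<close> is comparable to the possible shift of the
  mean.\<close>

definition cond_rate :: "real \<Rightarrow> real \<Rightarrow> real" where
  "cond_rate a b = min (1 / (16 * a)) (ln 2 / (4 * (2 * b + 4 * exp (a / 2))\<^sup>2))"

lemma cond_rate_pos: "a > 0 \<Longrightarrow> b \<ge> 0 \<Longrightarrow> cond_rate a b > 0"
proof -
  assume "a > 0" "b \<ge> 0"
  then have "2 * b + 4 * exp (a / 2) > 0" by (simp add: add_nonneg_pos)
  then show ?thesis using \<open>a > 0\<close> by (simp add: cond_rate_def)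
qed

text \<open>On \<open>A\<close> the function \<open>F\<close> differs from the sub-Gaussian
  \<open>g\<close> by at most the fluctuation scale \<open>R\<close>, up to a constant. Its
  conditional mean is then within a multiple of \<open>R\<close> of \<open>m\<close>, so a large
  deviation of \<open>F\<close> forces one of \<open>g\<close> of at least half the size, and
  conditioning at most doubles its probability.\<close>

lemma conditional_concentration:
  fixes F g :: "'a \<Rightarrow> real"
  assumes M: "prob_space M" and A: "A \<in> sets M" "measure M A \<ge> 1 / 2"
    and [measurable]: "F \<in> borel_measurable M" "g \<in> borel_measurable M"
    and B: "\<And>x. x \<in> space M \<Longrightarrow> \<bar>g x\<bar> \<le> B"
    and close: "\<And>x. x \<in> A \<Longrightarrow> \<bar>F x - g x\<bar> \<le> b * R"
    and sg: "subgaussian M m (a * R\<^sup>2) g" and pos: "a > 0" "b \<ge> 0" "R > 0"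
  defines "Q \<equiv> uniform_measure M A"
  shows "integrable Q F"
    and "\<epsilon> > 0 \<Longrightarrow> measure Q {x \<in> space Q. \<bar>F x - (\<integral>y. F y \<partial>Q)\<bar> \<ge> \<epsilon>} \<le> 2 * exp (- cond_rate a b * (\<epsilon> / R)\<^sup>2)"
proof -
  interpret M: prob_space M by fact
  have A0: "emeasure M A \<noteq> 0" "emeasure M A \<noteq> \<infinity>"
    using A by (auto simp: M.emeasure_eq_measure)
  interpret Q: prob_space Q unfolding Q_def by (rule prob_space_uniform_measure[OF A0])
  have [simp]: "space Q = space M" "sets Q = sets M" by (simp_all add: Q_def)
  have [measurable]: "F \<in> borel_measurable Q" "g \<in> borel_measurable Q"
    unfolding Q_def uniform_measure_def by auto
  have prob_Q [simp]: "measure Q (space M) = 1" using Q.prob_space by simp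
  have inA: "AE x in Q. x \<in> A" unfolding Q_def using A by (intro AE_uniform_measureI) auto
  have A_space: "A \<subseteq> space M" using A sets.sets_into_space by auto
  have intg: "integrable M g" using B by (intro integrable_bounded_prob[OF M]) auto
  show intF: "integrable Q F"
  proof (rule Q.integrable_const_bound)
    show "AE x in Q. norm (F x) \<le> B + b * R"
      using inA
    proof eventually_elim
      case (elim x)
      then show ?case using close[of x] B[of x] A_space by auto
    qed
  qed simp
  have intgQ: "integrable Q g" by (rule Q.integrable_const_bound[where B = B]) (use B in auto)
  \<comment> \<open>In units of \<open>R\<close>: the conditional mean of \<open>F\<close> is
    shifted from \<open>m\<close> by at most \<open>b + 4 * exp (a / 2)\<close>, and replacing
    \<open>F\<close> by \<open>g\<close> at a point costs another \<open>b\<close>.\<close>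
  define L where "L = 2 * b + 4 * exp (a / 2)"
  have L: "L > 0" using pos by (simp add: L_def add_nonneg_pos)
  let ?\<mu> = "\<integral>y. F y \<partial>Q"
  have "\<bar>?\<mu> - m\<bar> = \<bar>\<integral>y. F y - m \<partial>Q\<bar>" using intF by simp
  also have "\<dots> \<le> (\<integral>y. \<bar>F y - m\<bar> \<partial>Q)" by (rule integral_abs_bound)
  also have "\<dots> \<le> (\<integral>y. \<bar>g y - m\<bar> + b * R \<partial>Q)"
  proof (rule integral_mono_AE)
    show "AE y in Q. \<bar>F y - m\<bar> \<le> \<bar>g y - m\<bar> + b * R"
      using inA by eventually_elim (use close in force)
  qed (use intF intgQ in auto)
  also have "\<dots> = (\<integral>y. \<bar>g y - m\<bar> \<partial>Q) + b * R" using intgQ by simp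
  also have "(\<integral>y. \<bar>g y - m\<bar> \<partial>Q) \<le> 2 * (\<integral>y. \<bar>g y - m\<bar> \<partial>M)"
    unfolding Q_def by (rule integral_uniform_measure_le[OF M A]) (use intg in auto)
  also have "(\<integral>y. \<bar>g y - m\<bar> \<partial>M) \<le> 2 * R * exp (a / 2)"
    by (rule subgaussian_abs_mean[OF M sg]) (use pos intg in auto)
  finally have mean: "\<bar>?\<mu> - m\<bar> + b * R \<le> L * R" by (simp add: L_def algebra_simps)

  assume \<epsilon>: "\<epsilon> > 0"
  show "measure Q {x \<in> space Q. \<bar>F x - ?\<mu>\<bar> \<ge> \<epsilon>} \<le> 2 * exp (- cond_rate a b * (\<epsilon> / R)\<^sup>2)"
  \<comment> \<open>In the first case the right-hand side is at least 1.\<close>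
  proof (cases "\<epsilon> < 2 * L * R \<or> (\<epsilon> / R)\<^sup>2 / (16 * a) < ln 2")
    case True
    have "cond_rate a b * (\<epsilon> / R)\<^sup>2 \<le> ln 2"
    proof (cases "\<epsilon> < 2 * L * R")
      case True
      then have "\<epsilon> / R \<le> 2 * L" using pos by (simp add: divide_le_eq)
      then have "(\<epsilon> / R)\<^sup>2 \<le> (2 * L)\<^sup>2" using pos \<epsilon> by (intro power_mono) auto
      then have "cond_rate a b * (\<epsilon> / R)\<^sup>2 \<le> (ln 2 / (4 * L\<^sup>2)) * (2 * L)\<^sup>2"
        using cond_rate_pos[of a b] pos by (intro mult_mono) (auto simp: cond_rate_def L_def)
      also have "\<dots> = ln 2" using L by (simp add: power_mult_distrib)
      finally show ?thesis .
    next
      case False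
      have "cond_rate a b * (\<epsilon> / R)\<^sup>2 \<le> (1 / (16 * a)) * (\<epsilon> / R)\<^sup>2"
        by (intro mult_right_mono) (auto simp: cond_rate_def)
      then show ?thesis using False True by simp
    qed
    then have "exp (- ln 2) \<le> exp (- cond_rate a b * (\<epsilon> / R)\<^sup>2)" by simp
    then have "1 \<le> 2 * exp (- cond_rate a b * (\<epsilon> / R)\<^sup>2)" by (simp add: exp_minus)
    then show ?thesis using Q.prob_le_1 order_trans by blast
  next
    case False
    define z where "z = (\<epsilon> / R)\<^sup>2 / (16 * a)"
    have z: "ln 2 \<le> z" and \<epsilon>L: "2 * L * R \<le> \<epsilon>" using False by (auto simp: z_def)
    have "measure Q {x \<in> space Q. \<bar>F x - ?\<mu>\<bar> \<ge> \<epsilon>} = measure M (A \<inter> {x \<in> space M. \<bar>F x - ?\<mu>\<bar> \<ge> \<epsilon>}) / measure M A"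
      unfolding \<open>space Q = space M\<close> by (subst Q_def, rule measure_uniform_measure[OF A0]) measurable
    also have "\<dots> \<le> measure M (A \<inter> {x \<in> space M. \<bar>F x - ?\<mu>\<bar> \<ge> \<epsilon>}) / (1 / 2)"
      using A by (intro divide_left_mono) auto
    also have "\<dots> = 2 * measure M (A \<inter> {x \<in> space M. \<bar>F x - ?\<mu>\<bar> \<ge> \<epsilon>})" by simp
    also have "measure M (A \<inter> {x \<in> space M. \<bar>F x - ?\<mu>\<bar> \<ge> \<epsilon>}) \<le> measure M {x \<in> space M. \<bar>g x - m\<bar> \<ge> \<epsilon> / 2}"
    proof (rule M.finite_measure_mono)
      show "A \<inter> {x \<in> space M. \<epsilon> \<le> \<bar>F x - ?\<mu>\<bar>} \<subseteq> {x \<in> space M. \<epsilon> / 2 \<le> \<bar>g x - m\<bar>}"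
      proof
        fix x assume x: "x \<in> A \<inter> {x \<in> space M. \<epsilon> \<le> \<bar>F x - ?\<mu>\<bar>}"
        then have "\<epsilon> \<le> \<bar>F x - g x\<bar> + \<bar>g x - m\<bar> + \<bar>?\<mu> - m\<bar>" by (simp add: abs_if split: if_splits)
        also have "\<bar>F x - g x\<bar> \<le> b * R" using close x by auto
        finally have "\<epsilon> / 2 \<le> \<bar>g x - m\<bar>" using mean \<epsilon>L by simp
        then show "x \<in> {x \<in> space M. \<epsilon> / 2 \<le> \<bar>g x - m\<bar>}" using x by simp
      qed
    qed measurable
    also have "\<dots> \<le> 2 * exp (- (\<epsilon> / 2)\<^sup>2 / (2 * (a * R\<^sup>2)))"
      by (rule subgaussian_tail[OF M sg]) (use pos \<epsilon> in auto)
    also have "- (\<epsilon> / 2)\<^sup>2 / (2 * (a * R\<^sup>2)) = - z - z"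
      using pos by (simp add: z_def power_divide field_simps)
    \<comment> \<open>One factor 2 comes from conditioning and one from the two tails. Since
      \<open>z \<ge> ln 2\<close>, giving up one of the two copies of \<open>exp (- z)\<close>
      brings the 4 down to 2.\<close>
    also have "2 * (2 * exp (- z - z)) = 4 * (exp (- z) * exp (- z))" by (simp add: exp_add[symmetric])
    also have "\<dots> \<le> 4 * (exp (- ln 2) * exp (- z))"
      using z by (intro mult_left_mono mult_right_mono) auto
    also have "\<dots> = 2 * exp (- z)" by (simp add: exp_minus)
    also have "\<dots> \<le> 2 * exp (- cond_rate a b * (\<epsilon> / R)\<^sup>2)"
    proof -
      have "cond_rate a b * (\<epsilon> / R)\<^sup>2 \<le> (1 / (16 * a)) * (\<epsilon> / R)\<^sup>2"
        by (intro mult_right_mono) (auto simp: cond_rate_def)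
      then show ?thesis by (simp add: z_def)
    qed
    finally show ?thesis by simp
  qed
qed

text \<open>Negative parameters \<open>l\<close> are covered by applying the exponential bound to
  \<open>- f\<close>.\<close>

lemma bounded_differences_subgaussian:
  fixes f :: "('i \<Rightarrow> 'a) \<Rightarrow> real"
  assumes M: "prob_space M" and fin: "finite I"
    and meas: "f \<in> borel_measurable (PiM I (\<lambda>_. M))"
    and B: "\<And>x. x \<in> space (PiM I (\<lambda>_. M)) \<Longrightarrow> \<bar>f x\<bar> \<le> B"
    and diff: "\<And>x i y. x \<in> space (PiM I (\<lambda>_. M)) \<Longrightarrow> i \<in> I \<Longrightarrow> y \<in> space M \<Longrightarrow>
           \<bar>f (x(i := y)) - f x\<bar> \<le> c"
  shows "subgaussian (PiM I (\<lambda>_. M)) (\<integral>x. f x \<partial>PiM I (\<lambda>_. M)) (real (card I) * c\<^sup>2) f"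
proof -
  let ?P = "PiM I (\<lambda>_. M)"
  define m where "m = (\<integral>x. f x \<partial>?P)"
  have P: "prob_space ?P" by (intro prob_space_PiM M)
  have int: "integrable ?P (\<lambda>x. exp (l * (f x - m)))" for l
  proof (rule integrable_bounded_prob[OF P])
    fix x assume x: "x \<in> space ?P"
    have "l * (f x - m) \<le> \<bar>l * (f x - m)\<bar>" by simp
    also have "\<dots> \<le> \<bar>l\<bar> * (B + \<bar>m\<bar>)"
      unfolding abs_mult using B[OF x] by (intro mult_left_mono) auto
    finally show "\<bar>exp (l * (f x - m))\<bar> \<le> exp (\<bar>l\<bar> * (B + \<bar>m\<bar>))" by simp
  qed (use meas in measurable)
  have le: "(\<integral>x. exp (l * (f x - m)) \<partial>?P) \<le> exp (l\<^sup>2 * (real (card I) * c\<^sup>2) / 2)" if "l \<noteq> 0" for l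
  proof -
    have "(\<integral>x. exp (l * f x) \<partial>?P) \<le> exp (real (card I) * (l\<^sup>2 * c\<^sup>2 / 2)) * exp (l * m)"
    proof (cases "l > 0")
      case True
      from bounded_differences_mgf[OF M fin this meas B diff] show ?thesis by (simp add: m_def)
    next
      case False
      then have l: "- l > 0" using that by simp
      have "(\<integral>x. exp (- l * - f x) \<partial>?P)
          \<le> exp (real (card I) * ((- l)\<^sup>2 * c\<^sup>2 / 2)) * exp (- l * (\<integral>x. - f x \<partial>?P))"
      proof (rule bounded_differences_mgf[OF M fin l, where B = B])
        show "(\<lambda>x. - f x) \<in> borel_measurable ?P" using meas by measurable
        show "\<bar>- f (x(i := y)) - - f x\<bar> \<le> c" if "x \<in> space ?P" "i \<in> I" "y \<in> space M" for x i y
          using diff[OF that] by linarith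
      qed (use B in auto)
      then show ?thesis by (simp add: m_def)
    qed
    then have "(\<integral>x. exp (l * f x) \<partial>?P) * exp (- l * m)
        \<le> exp (real (card I) * (l\<^sup>2 * c\<^sup>2 / 2)) * exp (l * m) * exp (- l * m)"
      by (intro mult_right_mono) auto
    also have "\<dots> = exp (l\<^sup>2 * (real (card I) * c\<^sup>2) / 2)"
      by (simp add: exp_add[symmetric] mult_ac)
    also have "(\<integral>x. exp (l * f x) \<partial>?P) * exp (- l * m) = (\<integral>x. exp (l * (f x - m)) \<partial>?P)"
      by (subst integral_mult_left_zero[symmetric]) (simp add: exp_add[symmetric] algebra_simps)
    finally show ?thesis .
  qed
  show ?thesis using int le unfolding subgaussian_def m_def by blast
qed

subsection \<open>The truncated volume and the good event\<close>

text \<open>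
  The points lie on the sphere only almost surely, whereas bounded differences are required at every
  point of the product space; replacing off-sphere points by a fixed unit vector achieves this.
\<close>

definition sphere_retract :: "real ^ 'n \<Rightarrow> real ^ 'n" where
  "sphere_retract x = (if norm x = 1 then x else axis undefined 1)"

lemma norm_sphere_retract: "norm (sphere_retract x) = 1"
  by (simp add: sphere_retract_def norm_axis_1)

lemma sphere_retract_borel [measurable]: "sphere_retract \<in> borel_measurable borel"
  unfolding sphere_retract_def by measurable

lemma ball_diff_sphere_retract:
  "(\<And>i. i \<in> {1..N} \<Longrightarrow> norm (X i) = 1) \<Longrightarrow> ball_diff N (\<lambda>i. sphere_retract (X i)) = ball_diff N X"
  by (simp add: ball_diff_def polytope_of_def sphere_retract_def)

text \<open>The cut-off is the radius beyond which a point of the polytope must lie over an empty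
  ball of scale \<open>r\<close>.\<close>

definition truncated_volume :: "real \<Rightarrow> nat \<Rightarrow> (nat \<Rightarrow> real ^ 'n) \<Rightarrow> real" where
  "truncated_volume r N X = measure lborel (ball_diff N (\<lambda>i. sphere_retract (X i)) \<inter> cball 0 (1 + (3 * r)\<^sup>2))"

text \<open>Twice the cap bound with powers of \<open>r\<close> removed: the cap has height at most
  \<open>18 * r\<^sup>2\<close> and its directions lie within \<open>6 * r\<close> of its
  centre.\<close>

definition diff_const :: "'n::finite itself \<Rightarrow> real" where
  "diff_const _ = 2 * (real CARD('n) * 2 ^ CARD('n) * 18 *
     (2 ^ (CARD('n) + 1) * unit_ball_vol (real CARD('n)) * 6 ^ (CARD('n) - 1)))"

lemma diff_const_pos: "diff_const TYPE('n::finite) > 0"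
  by (simp add: diff_const_def)

lemma cap_eps_nonneg: "0 \<le> cap_eps T N"
  by (simp add: cap_eps_def)

lemma cap_height_bounds:
  assumes "cap_eps TYPE('n::finite) N \<le> 1 / 2"
  shows "0 < cap_height TYPE('n) N" "1 - cap_height TYPE('n) N \<le> (cap_eps TYPE('n) N)\<^sup>2"
proof -
  let ?e = "(cap_eps TYPE('n) N)\<^sup>2"
  have e: "0 \<le> ?e" "?e \<le> 1 / 4"
    using power_mono[OF assms cap_eps_nonneg, of 2] by (auto simp: power_divide)
  have "(1 - ?e)\<^sup>2 = (1 - ?e) * (1 - ?e)" by (simp add: power2_eq_square)
  also have "\<dots> \<le> (1 - ?e) * 1" using e by (intro mult_left_mono) auto
  finally have "1 - ?e \<le> cap_height TYPE('n) N"
    unfolding cap_height_def by (intro real_le_rsqrt) simp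
  then show "0 < cap_height TYPE('n) N" "1 - cap_height TYPE('n) N \<le> ?e" using e by linarith+
qed

lemma truncated_volume_measurable:
  "truncated_volume r N \<in> borel_measurable (iid_sphere N :: (nat \<Rightarrow> real ^ 'n) measure)"
  unfolding truncated_volume_def[abs_def] by (rule measure_ball_diff_measurable) auto

lemma truncated_volume_bounded:
  fixes X :: "nat \<Rightarrow> real ^ 'n"
  shows "\<bar>truncated_volume r N X\<bar> \<le> measure lborel (cball 0 (1 + (3 * r)\<^sup>2) :: (real ^ 'n) set)"
proof -
  have "truncated_volume r N X \<le> measure lborel (cball 0 (1 + (3 * r)\<^sup>2) :: (real ^ 'n) set)"
    unfolding truncated_volume_def by (rule measure_mono_fmeasurable) auto
  then show ?thesis by (simp add: truncated_volume_def)
qed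

text \<open>The truncation and the cap depth each contribute at most \<open>9 * r\<^sup>2\<close> to
  \<open>?\<rho> - ?t\<close>, since \<open>cap_eps\<close> is at most \<open>3 * r\<close>. So a
  cap has directions within \<open>6 * r\<close> of its centre, and changing one point moves the
  volume by \<open>O(r ^ (CARD('n) + 1))\<close>.\<close>

lemma truncated_volume_subgaussian:
  assumes r: "0 < r" "6 * r \<le> 1" and eps: "cap_eps TYPE('n::finite) N \<le> 3 * r"
  shows "subgaussian (iid_sphere N) (\<integral>X. truncated_volume r N X \<partial>(iid_sphere N :: (nat \<Rightarrow> real ^ 'n) measure))
    (real N * (diff_const TYPE('n) * r ^ (CARD('n) + 1))\<^sup>2) (truncated_volume r N :: (nat \<Rightarrow> real ^ 'n) \<Rightarrow> real)"
proof -
  let ?S = "sphere_uniform :: (real ^ 'n) measure" and ?t = "cap_height TYPE('n) N"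
  let ?\<rho> = "1 + (3 * r)\<^sup>2"
  let ?g = "truncated_volume r N :: (nat \<Rightarrow> real ^ 'n) \<Rightarrow> real"
  have "(3 * r)\<^sup>2 \<le> 1" by (rule power_le_one) (use r in auto)
  then have \<rho>: "1 \<le> ?\<rho>" "?\<rho> \<le> 2" by auto
  have t: "0 < ?t" "1 - ?t \<le> (cap_eps TYPE('n) N)\<^sup>2"
    using cap_height_bounds[where 'n = 'n, of N] eps r by auto
  have "(cap_eps TYPE('n) N)\<^sup>2 \<le> (3 * r)\<^sup>2" using eps cap_eps_nonneg by (intro power_mono)
  then have \<rho>t: "?\<rho> - ?t \<le> 18 * r\<^sup>2" using t by (simp add: power_mult_distrib)
  have t1: "?t \<le> 1" by (rule cap_height_le_1)
  have frac: "2 - 2 * t / y = 2 * (y - t) / y" if "y \<ge> 1" for y t :: real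
    using that by (simp add: field_simps)
  have frac_le1: "2 * (y - t) / y \<le> 2 * (y - t) / 1" if "y \<ge> 1" "t \<le> 1" for y t :: real
    using that by (intro divide_left_mono) auto
  have "2 - 2 * ?t / ?\<rho> = 2 * (?\<rho> - ?t) / ?\<rho>" by (rule frac[OF \<rho>(1)])
  also have "\<dots> \<le> 2 * (?\<rho> - ?t) / 1" by (rule frac_le1[OF \<rho>(1) t1])
  also have "\<dots> \<le> (6 * r)\<^sup>2" using \<rho>t by (simp add: power_mult_distrib)
  finally have h: "2 - 2 * ?t / ?\<rho> \<le> (6 * r)\<^sup>2" .
  have diff: "\<bar>?g (X(i := y)) - ?g X\<bar> \<le> diff_const TYPE('n) * r ^ (CARD('n) + 1)" for X i and y :: "real ^ 'n"
  proof -
    have "\<bar>?g (X(i := y)) - ?g X\<bar> \<le> 2 * (real CARD('n) * 2 ^ CARD('n) * (?\<rho> - ?t) *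
        (2 ^ (CARD('n) + 1) * unit_ball_vol (real CARD('n)) * (6 * r) ^ (CARD('n) - 1)))"
      unfolding truncated_volume_def
      by (rule ball_diff_Int_change_one[where i = i]) (use norm_sphere_retract \<rho> t h r in auto)
    also have "\<dots> \<le> 2 * (real CARD('n) * 2 ^ CARD('n) * (18 * r\<^sup>2) *
        (2 ^ (CARD('n) + 1) * unit_ball_vol (real CARD('n)) * (6 * r) ^ (CARD('n) - 1)))"
      using \<rho>t r by (intro mult_left_mono mult_right_mono) auto
    also have "\<dots> = diff_const TYPE('n) * (r\<^sup>2 * r ^ (CARD('n) - 1))"
      by (simp add: diff_const_def power_mult_distrib mult_ac)
    also have "r\<^sup>2 * r ^ (CARD('n) - 1) = r ^ (CARD('n) + 1)"
      by (cases "CARD('n)") (simp_all add: power2_eq_square)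
    finally show ?thesis .
  qed
  have "subgaussian (PiM {1..N} (\<lambda>_. ?S)) (\<integral>X. ?g X \<partial>PiM {1..N} (\<lambda>_. ?S))
      (real (card {1..N}) * (diff_const TYPE('n) * r ^ (CARD('n) + 1))\<^sup>2) ?g"
    by (rule bounded_differences_subgaussian[OF prob_space_sphere_uniform _ _ truncated_volume_bounded diff])
       (use truncated_volume_measurable[of r N] in \<open>auto simp: iid_sphere_def\<close>)
  then show ?thesis by (simp add: iid_sphere_def)
qed

lemma prob_iid_sphere_on_sphere:
  "measure (iid_sphere N :: (nat \<Rightarrow> real ^ 'n) measure) (\<Pi>\<^sub>E i\<in>{1..N}. sphere 0 1) = 1"
proof -
  interpret S: prob_space "sphere_uniform :: (real ^ 'n) measure" by (rule prob_space_sphere_uniform)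
  interpret finite_product_prob_space "\<lambda>_. sphere_uniform :: (real ^ 'n) measure" "{1..N}"
    by unfold_locales auto
  have "measure (sphere_uniform :: (real ^ 'n) measure) (sphere 0 1) = 1"
    using AE_sphere_uniform by (subst S.AE_in_set_eq_1[symmetric]) auto
  moreover have "prob (\<Pi>\<^sub>E i\<in>{1..N}. sphere 0 1) = (\<Prod>i\<in>{1..N}. S.prob (sphere 0 1))"
    by (rule prob_times) auto
  ultimately show ?thesis unfolding iid_sphere_def by simp
qed

text \<open>The 9 stems from the shell thickness \<open>(3 * r')\<^sup>2\<close>, the last power of
  2 from the cap radius \<open>2 * r\<close>.\<close>

definition outer_const :: "'n::finite itself \<Rightarrow> real" where
  "outer_const _ = real CARD('n) * 2 ^ CARD('n) * 9 *
     (2 ^ (CARD('n) + 1) * unit_ball_vol (real CARD('n)) * 2 ^ (CARD('n) - 1))"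

lemma outer_const_pos: "outer_const TYPE('n::finite) > 0"
  by (simp add: outer_const_def)

text \<open>The event asks that all sample points lie on the sphere, that fewer than
  \<open>k\<close> balls of a net at scale \<open>r\<close> are empty, and that none is empty at
  scale \<open>r'\<close>. The nets have at most \<open>1 / q\<close> and \<open>1 / q'\<close>
  points, which gives the two failure terms.\<close>

lemma good_event_exists:
  fixes r r' :: real and N k :: nat
  assumes r: "0 < r" "3 * r \<le> 1" and r': "0 < r'" "3 * r' \<le> 1"
  defines "q \<equiv> cap_const TYPE('n::finite) * r ^ (CARD('n) - 1)"
    and "q' \<equiv> cap_const TYPE('n) * r' ^ (CARD('n) - 1)"
  shows "\<exists>A \<in> sets (iid_sphere N :: (nat \<Rightarrow> real ^ 'n) measure).
    1 - ((1 / q) ^ k * exp (- real N * (real k * q)) + (1 / q') * exp (- real N * q')) \<le> measure (iid_sphere N) A \<and>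
    (\<forall>X\<in>A. ball_diff N X \<subseteq> cball 0 2 \<and>
      \<bar>measure lborel (ball_diff N X) - truncated_volume r N X\<bar>
        \<le> real k * (outer_const TYPE('n) * r'\<^sup>2 * r ^ (CARD('n) - 1)))"
proof -
  let ?M = "iid_sphere N :: (nat \<Rightarrow> real ^ 'n) measure"
  interpret prob_space ?M by (rule prob_space_iid_sphere)
  have q: "q > 0" "q' > 0" using r r' cap_const_pos[where 'n = 'n] by (auto simp: q_def q'_def)
  obtain T :: "(real ^ 'n) set" where T: "packing r T" "T \<subseteq> sphere 0 1" "spherical_net r T" "real (card T) * q \<le> 1"
    using sphere_net_exists[where 'n = 'n, of r] r unfolding spherical_net_def q_def by auto
  obtain T' :: "(real ^ 'n) set" where T': "packing r' T'" "T' \<subseteq> sphere 0 1" "spherical_net r' T'" "real (card T') * q' \<le> 1"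
    using sphere_net_exists[where 'n = 'n, of r'] r' unfolding spherical_net_def q'_def by auto
  have fin: "finite T" "finite T'" using T T' by (auto simp: packing_def)
  note [measurable] = card_empty_balls_measurable[OF fin(1)] card_empty_balls_measurable[OF fin(2)]
  define S where "S = ((\<Pi>\<^sub>E i\<in>{1..N}. sphere 0 1) :: (nat \<Rightarrow> real ^ 'n) set)"
  define E where "E = {X \<in> space ?M. k \<le> card (empty_balls N r T X)}"
  define E' where "E' = {X \<in> space ?M. 1 \<le> card (empty_balls N r' T' X)}"
  have [measurable]: "E \<in> sets ?M" "E' \<in> sets ?M" unfolding E_def E'_def by measurable
  have [measurable]: "S \<in> sets ?M" unfolding S_def iid_sphere_def by (intro sets_PiM_I_finite) auto
  have E: "prob E \<le> (1 / q) ^ k * exp (- real N * (real k * q))"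
  proof -
    have "prob E \<le> real (card T) ^ k * exp (- real N * (real k * q))"
      unfolding E_def q_def using prob_empty_balls_ge[of r T] T r by simp
    also have "\<dots> \<le> (1 / q) ^ k * exp (- real N * (real k * q))"
      using T q by (intro mult_right_mono power_mono) (auto simp: field_simps)
    finally show ?thesis .
  qed
  have E': "prob E' \<le> (1 / q') * exp (- real N * q')"
  proof -
    have "prob E' \<le> real (card T') ^ 1 * exp (- real N * (real 1 * q'))"
      unfolding E'_def q'_def by (rule prob_empty_balls_ge) (use T' r' in auto)
    also have "\<dots> \<le> (1 / q') * exp (- real N * q')"
      using T' q by (simp add: field_simps mult_right_mono)
    finally show ?thesis .
  qed
  have "1 = prob S" unfolding S_def by (rule prob_iid_sphere_on_sphere[symmetric])
  also have "\<dots> \<le> prob ((S - (E \<union> E')) \<union> (E \<union> E'))" by (intro finite_measure_mono) auto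
  also have "\<dots> \<le> prob (S - (E \<union> E')) + (prob E + prob E')"
    by (intro order_trans[OF measure_Un_le] add_left_mono measure_Un_le) auto
  finally have prob: "1 - ((1 / q) ^ k * exp (- real N * (real k * q)) + (1 / q') * exp (- real N * q'))
      \<le> prob (S - (E \<union> E'))" using E E' by linarith
  have good: "ball_diff N X \<subseteq> cball 0 2 \<and>
      \<bar>measure lborel (ball_diff N X) - truncated_volume r N X\<bar>
        \<le> real k * (outer_const TYPE('n) * r'\<^sup>2 * r ^ (CARD('n) - 1))" if X: "X \<in> S - (E \<union> E')" for X
  proof -
    have "X \<in> space ?M" using X sets.sets_into_space[of S ?M] by auto
    then have "card (empty_balls N r' T' X) < 1" and few: "card (empty_balls N r T X) \<le> k"
      using X by (auto simp: E_def E'_def)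
    moreover have "finite (empty_balls N r' T' X)" using fin by (simp add: empty_balls_def)
    ultimately have none: "empty_balls N r' T' X = {}" by (simp add: card_eq_0_iff)
    have norm: "norm (X i) = 1" if "i \<in> {1..N}" for i using X that by (auto simp: S_def PiE_iff)
    note outer = ball_diff_outer_part[where N = N and X = X and k = k, OF T(3) fin(1) T(2) r T'(3) r' norm none few]
    have "truncated_volume r N X = measure lborel (ball_diff N X \<inter> cball 0 (1 + (3 * r)\<^sup>2))"
      using ball_diff_sphere_retract[of N X] norm by (simp add: truncated_volume_def)
    then show ?thesis using outer by (simp add: outer_const_def power_mult_distrib mult_ac)
  qed
  show ?thesis using prob good by (intro bexI[of _ "S - (E \<union> E')"]) auto
qed

section \<open>Elementary estimates for large \<open>N\<close>\<close>

text \<open>The bounds by \<open>(1 / 6) powr m\<close> make both radii at most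
  \<open>1 / 6\<close>. The one with \<open>C'\<close> places \<open>cap_eps\<close> below
  \<open>r\<close>, and the last two give the stated probability of the event and a probability of
  at least \<open>1 / 2\<close> for conditioning.\<close>

lemma eventually_growth:
  fixes a b C C' m :: real
  assumes "b > 0" "a < b" "b < 1" "C > 0" "m \<ge> 1"
  shows "\<forall>\<^sub>F x in at_top. 1 \<le> ln x \<and> ln x \<le> x powr b \<and> C * ln x / x \<le> (1 / 6) powr m \<and>
    C * x powr (b - 1) \<le> (1 / 6) powr m \<and> C' \<le> C * ln x \<and>
    2 * exp (- (x powr b)) \<le> exp (- (x powr a * ln x)) \<and> 2 * exp (- (x powr b)) \<le> 1 / 2"
proof -
  have p: "(1 / 6) powr m > 0" by simp
  have 1: "\<forall>\<^sub>F x in at_top. 1 \<le> ln (x :: real)" by real_asymp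
  have 2: "\<forall>\<^sub>F x in at_top. ln (x :: real) \<le> x powr b" using assms by real_asymp
  have "((\<lambda>x. C * ln x / x) \<longlongrightarrow> 0) at_top" by real_asymp
  from order_tendstoD(2)[OF this p] have 3: "\<forall>\<^sub>F x in at_top. C * ln x / x < (1 / 6) powr m" .
  have "((\<lambda>x. C * x powr (b - 1)) \<longlongrightarrow> 0) at_top" using assms by real_asymp
  from order_tendstoD(2)[OF this p] have 4: "\<forall>\<^sub>F x in at_top. C * x powr (b - 1) < (1 / 6) powr m" .
  have "filterlim (\<lambda>x. C * ln x) at_top at_top" using assms by real_asymp
  then have 5: "\<forall>\<^sub>F x in at_top. C' \<le> C * ln x" by (simp add: filterlim_at_top)
  have "filterlim (\<lambda>x. x powr b - x powr a * ln x) at_top at_top" using assms by real_asymp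
  then have 6: "\<forall>\<^sub>F x in at_top. ln 2 \<le> x powr b - x powr a * ln x" by (simp add: filterlim_at_top)
  have "filterlim (\<lambda>x::real. x powr b) at_top at_top" using assms by real_asymp
  then have 7: "\<forall>\<^sub>F x :: real in at_top. ln 4 \<le> x powr b" by (simp add: filterlim_at_top)
  show ?thesis
    using 1 2 3 4 5 6 7
  proof eventually_elim
    case (elim x)
    have "2 * exp (- (x powr b)) = exp (ln 2 - x powr b)" by (simp add: exp_diff exp_minus field_simps)
    also have "\<dots> \<le> exp (- (x powr a * ln x))" using elim by simp
    finally have A: "2 * exp (- (x powr b)) \<le> exp (- (x powr a * ln x))" .
    have "exp (- (x powr b)) \<le> exp (- ln 4)" using elim by (subst exp_le_cancel_iff) linarith
    also have "\<dots> = (1 / 4 :: real)" by (simp add: exp_minus)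
    finally have "exp (- (x powr b)) \<le> 1 / 4" .
    with A elim show ?case by auto
  qed
qed

lemma power_powr_inverse:
  fixes y :: real
  assumes "y > 0" "d \<ge> 2"
  shows "(y powr (1 / (real d - 1))) ^ k = y powr (real k / (real d - 1))"
  using assms by (simp add: powr_powr flip: powr_realpow)

text \<open>Choosing the subset costs at most \<open>x ^ k\<close>, that is
  \<open>exp (real k * ln x)\<close>, while the emptiness gains
  \<open>exp (- 2 * real k * ln x)\<close>. The factor 2 in the cap measure leaves one
  \<open>real k * ln x\<close> over, which is at least \<open>B\<close>.\<close>

lemma many_empty_bound:
  fixes x B :: real
  assumes x: "x > 0" and L: "1 \<le> ln x" and k: "B / ln x \<le> real k"
  shows "(1 / (2 * ln x / x)) ^ k * exp (- x * (real k * (2 * ln x / x))) \<le> exp (- B)"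
proof -
  have lx: "2 * ln x \<ge> 1" using L by linarith
  then have "x * 1 \<le> x * (2 * ln x)" using x by (intro mult_left_mono) auto
  moreover have "0 < 2 * ln x" using lx by linarith
  ultimately have "1 / (2 * ln x / x) \<le> x" by (simp only: divide_divide_eq_right mult_1_left pos_divide_le_eq mult_1_right)
  moreover have "0 < 2 * ln x / x" by (rule divide_pos_pos) (use lx x in linarith)+
  then have "0 \<le> 1 / (2 * ln x / x)" by (simp only: zero_le_divide_1_iff less_imp_le)
  ultimately have "(1 / (2 * ln x / x)) ^ k \<le> x ^ k" by (rule power_mono)
  also have "x ^ k = exp (real k * ln x)" using x by (simp add: exp_of_nat_mult)
  finally have "(1 / (2 * ln x / x)) ^ k * exp (- x * (real k * (2 * ln x / x)))
      \<le> exp (real k * ln x) * exp (- x * (real k * (2 * ln x / x)))"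
    by (rule mult_right_mono) simp
  also have "\<dots> = exp (- (real k * ln x))"
    using x by (simp flip: exp_add)
  also have "\<dots> \<le> exp (- B)"
  proof -
    have "ln x > 0" using L by linarith
    then have "B \<le> real k * ln x" using k by (simp only: pos_divide_le_eq)
    then show ?thesis by simp
  qed
  finally show ?thesis .
qed

lemma single_empty_bound:
  fixes x q B :: real
  assumes x: "x > 0" and B: "ln x \<le> B" "1 \<le> B" and q: "x * q = 2 * B"
  shows "1 / q * exp (- x * q) \<le> exp (- B)"
proof -
  have "x * q > 0" using q B by linarith
  then have "q > 0" using x by (simp add: zero_less_mult_iff)
  then have "1 / q \<le> x" using q B by (simp add: divide_le_eq)
  then have "1 / q * exp (- x * q) \<le> x * exp (- x * q)" by (rule mult_right_mono) simp
  also have "\<dots> = exp (ln x) * exp (- (2 * B))"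
    using x q by simp
  also have "\<dots> = exp (ln x - 2 * B)" by (simp flip: exp_add)
  also have "\<dots> \<le> exp (- B)" using B by simp
  finally show ?thesis .
qed

section \<open>Choice of the scales and concentration for a fixed large \<open>N\<close>\<close>

text \<open>\<open>R\<close> is the common scale: the variance proxy
  \<open>x * r ^ (2 * (d + 1))\<close> is a constant multiple of \<open>R\<^sup>2\<close>, and the
  discarded volume is at most a constant multiple of \<open>R\<close>. The 2 in \<open>C\<close>
  makes a ball of radius \<open>r\<close> have expected sample count at least
  \<open>2 * ln x\<close>.\<close>

lemma conditional_concentration_at:
  fixes N :: nat
  defines "d \<equiv> CARD('n::finite)"
  defines "m \<equiv> real d - 1"
  defines "b \<equiv> m / (2 * (m + 2))" and "C \<equiv> 2 / cap_const TYPE('n)" and "x \<equiv> real N"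
  defines "R \<equiv> x powr (- 1 / 2 - 2 / m) * ln x powr (1 + 2 / m)"
  defines "\<alpha> \<equiv> (diff_const TYPE('n))\<^sup>2 * (C powr (1 + 2 / m))\<^sup>2" and "\<beta> \<equiv> 2 * outer_const TYPE('n) * C powr (1 + 2 / m)"
  assumes d: "d \<ge> 2"
    and L: "1 \<le> ln x" "ln x \<le> x powr b" and small: "C * ln x / x \<le> (1 / 6) powr m" "C * x powr (b - 1) \<le> (1 / 6) powr m"
    and large: "ln 2 * sphere_area TYPE('n) / unit_ball_vol (real d - 1) \<le> C * ln x"
    and half: "2 * exp (- (x powr b)) \<le> 1 / 2"
  shows "\<exists>A \<in> sets (iid_sphere N :: (nat \<Rightarrow> real ^ 'n) measure).
      1 - 2 * exp (- (x powr b)) \<le> measure (iid_sphere N) A \<and>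
      (AE X in cond_law N A. ball_diff N X \<in> fmeasurable lborel) \<and>
      integrable (cond_law N A) (\<lambda>X. measure lborel (ball_diff N X)) \<and>
      (\<forall>\<epsilon> > 0.
        measure (cond_law N A)
          {X \<in> space (cond_law N A).
            \<bar>measure lborel (ball_diff N X)
              - (\<integral>Y. measure lborel (ball_diff N Y) \<partial>cond_law N A)\<bar> \<ge> \<epsilon>}
        \<le> 2 * exp (- cond_rate \<alpha> \<beta> * (\<epsilon> / R)\<^sup>2))"
proof -
  let ?M = "iid_sphere N :: (nat \<Rightarrow> real ^ 'n) measure"
  let ?\<kappa> = "cap_const TYPE('n)"
  have \<kappa>: "?\<kappa> > 0" and C: "C > 0" and m: "m \<ge> 1"
    using cap_const_pos[where 'n = 'n] d by (auto simp: C_def m_def)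
  have "x \<noteq> 0" using L by auto
  then have x: "x > 0" by (simp add: x_def)
  have lx: "ln x > 0" using L by simp
  have x1: "x > 1" using lx x by simp
  define y where "y = C * ln x / x"
  define z where "z = C * x powr (b - 1)"
  have y: "y > 0" and z: "z > 0" using C x lx by (auto simp: y_def z_def)
  define r where "r = y powr (1 / m)"
  define r' where "r' = z powr (1 / m)"
  \<comment> \<open>The least number of empty balls for which \<open>exp (- (real k * ln x))\<close>
    falls below \<open>exp (- (x powr b))\<close>.\<close>
  define k where "k = nat \<lceil>x powr b / ln x\<rceil>"
  have r0: "r > 0" "r' > 0" using y z by (auto simp: r_def r'_def)
  have sixth: "u powr (1 / m) \<le> 1 / 6" if "0 < u" "u \<le> (1 / 6) powr m" for u :: real
  proof -
    have "u powr (1 / m) \<le> ((1 / 6) powr m) powr (1 / m)" using that m by (intro powr_mono2) auto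
    also have "\<dots> = 1 / 6" using m by (simp add: powr_powr)
    finally show ?thesis .
  qed
  have r6: "6 * r \<le> 1" "6 * r' \<le> 1"
    using sixth[OF y] sixth[OF z] small by (auto simp: r_def r'_def y_def z_def)
  have r_pow: "r ^ j = y powr (real j / m)" and r'_pow: "r' ^ j = z powr (real j / m)" for j
    using power_powr_inverse[OF y d] power_powr_inverse[OF z d] by (auto simp: r_def r'_def m_def)
  have dm: "real (d - 1) / m = 1" "real (d + 1) / m = 1 + 2 / m"
    using d m by (auto simp: m_def of_nat_diff field_simps)
  have rd: "r ^ (d - 1) = y" "r' ^ (d - 1) = z"
    unfolding r_pow r'_pow dm using y z by simp_all

  have wpos: "unit_ball_vol (real d - 1) > 0" using d by simp
  have "cap_eps TYPE('n) N \<le> r"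
    unfolding cap_eps_def r_def m_def d_def[symmetric] x_def[symmetric]
  proof (rule powr_mono2)
    have "ln 2 * sphere_area TYPE('n) / (x * unit_ball_vol (real d - 1))
        = (ln 2 * sphere_area TYPE('n) / unit_ball_vol (real d - 1)) / x" by simp
    also have "\<dots> \<le> (C * ln x) / x" using large x by (intro divide_right_mono) auto
    finally show "ln 2 * sphere_area TYPE('n) / (x * unit_ball_vol (real d - 1)) \<le> y"
      by (simp add: y_def)
    show "0 \<le> ln 2 * sphere_area TYPE('n) / (x * unit_ball_vol (real d - 1))"
      using x wpos by (simp add: sphere_area_eq)
  qed (use d in auto)
  then have eps: "cap_eps TYPE('n) N \<le> 3 * r" using r0 by simp

  have xb: "x powr b > 0" using x by simp
  \<comment> \<open>Hence rounding up in \<open>k\<close> at most doubles the quotient.\<close>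
  have "1 \<le> x powr b / ln x" using L lx by simp
  then have k1: "x powr b / ln x \<le> real k" and k2: "real k \<le> 2 * (x powr b / ln x)"
    unfolding k_def by linarith+

  have qy: "?\<kappa> * y = 2 * ln x / x" using \<kappa> by (simp add: y_def C_def)
  have qz: "?\<kappa> * z = 2 * x powr (b - 1)" using \<kappa> by (simp add: z_def C_def)
  have p1: "(1 / (?\<kappa> * y)) ^ k * exp (- real N * (real k * (?\<kappa> * y))) \<le> exp (- (x powr b))"
    unfolding qy x_def[symmetric] by (rule many_empty_bound[OF x L(1) k1])
  have "x * x powr (b - 1) = x powr b" using x by (simp add: powr_diff)
  then have "x * (?\<kappa> * z) = 2 * x powr b" unfolding qz by (simp only: mult.left_commute[of x])
  then have p2: "1 / (?\<kappa> * z) * exp (- real N * (?\<kappa> * z)) \<le> exp (- (x powr b))"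
    unfolding x_def[symmetric] using L by (intro single_empty_bound[OF x]) auto

  obtain A where A: "A \<in> sets ?M"
    and A_prob: "1 - ((1 / (?\<kappa> * y)) ^ k * exp (- real N * (real k * (?\<kappa> * y)))
        + 1 / (?\<kappa> * z) * exp (- real N * (?\<kappa> * z))) \<le> measure ?M A"
    and A_bd: "\<And>X. X \<in> A \<Longrightarrow> ball_diff N X \<subseteq> cball 0 2"
    and A_close: "\<And>X. X \<in> A \<Longrightarrow> \<bar>measure lborel (ball_diff N X) - truncated_volume r N X\<bar>
        \<le> real k * (outer_const TYPE('n) * r'\<^sup>2 * y)"
    using good_event_exists[where 'n = 'n and N = N and k = k, of r r'] r0 r6 unfolding d_def[symmetric] rd
    by auto
  have prob_ge: "1 - 2 * exp (- (x powr b)) \<le> measure ?M A" using A_prob p1 p2 by linarith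
  then have A_half: "1 / 2 \<le> measure ?M A" using half by linarith

  have R: "R > 0" using x lx by (simp add: R_def)
  \<comment> \<open>The standard deviation scale: \<open>y powr (1 + 2 / m)\<close> is
    \<open>r ^ (d + 1)\<close>, and \<open>sqrt x\<close> accounts for the number of
    coordinates.\<close>
  have xR: "sqrt x * y powr (1 + 2 / m) = C powr (1 + 2 / m) * R"
  proof -
    have "y powr (1 + 2 / m) = C powr (1 + 2 / m) * ln x powr (1 + 2 / m) / x powr (1 + 2 / m)"
      using C lx x by (simp add: y_def powr_divide powr_mult)
    then have "sqrt x * y powr (1 + 2 / m)
        = C powr (1 + 2 / m) * ((sqrt x / x powr (1 + 2 / m)) * ln x powr (1 + 2 / m))"
      by simp
    also have "sqrt x / x powr (1 + 2 / m) = x powr (1 / 2 - (1 + 2 / m))"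
      unfolding powr_diff[of x "1 / 2" "1 + 2 / m"] using x by (simp only: powr_half_sqrt less_imp_le)
    also have "1 / 2 - (1 + 2 / m) = - 1 / 2 - 2 / m" by simp
    finally show ?thesis by (simp only: R_def)
  qed
  have var: "x * (diff_const TYPE('n) * r ^ (d + 1))\<^sup>2 = \<alpha> * R\<^sup>2"
  proof -
    have "x * (diff_const TYPE('n) * r ^ (d + 1))\<^sup>2 = (diff_const TYPE('n))\<^sup>2 * (sqrt x * r ^ (d + 1))\<^sup>2"
      using x by (simp add: power_mult_distrib)
    also have "sqrt x * r ^ (d + 1) = C powr (1 + 2 / m) * R"
      unfolding r_pow dm by (rule xR)
    finally show ?thesis by (simp add: \<alpha>_def power_mult_distrib)
  qed
  have close_le: "real k * (outer_const TYPE('n) * r'\<^sup>2 * y) \<le> \<beta> * R"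
  proof -
    have r'_sq: "r'\<^sup>2 = C powr (2 / m) * x powr ((b - 1) * (2 / m))"
      unfolding r'_pow using C x by (simp add: z_def powr_mult powr_powr)
    have "real k * (outer_const TYPE('n) * r'\<^sup>2 * y)
        \<le> 2 * (x powr b / ln x) * (outer_const TYPE('n) * r'\<^sup>2 * y)"
      using k2 y outer_const_pos[where 'n = 'n] by (intro mult_right_mono) (auto simp: less_imp_le)
    also have "2 * (x powr b / ln x) * (outer_const TYPE('n) * r'\<^sup>2 * y)
        = 2 * outer_const TYPE('n) * (C * C powr (2 / m)) * (x powr b * x powr ((b - 1) * (2 / m)) / x)"
      unfolding r'_sq using lx x by (simp add: y_def field_simps)
    also have "C * C powr (2 / m) = C powr (1 + 2 / m)" using C by (simp add: powr_add)
    also have "x powr b * x powr ((b - 1) * (2 / m)) / x = x powr (b + (b - 1) * (2 / m) - 1)"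
      using x by (simp add: powr_add powr_diff)
    \<comment> \<open>This is the equation that determines \<open>b\<close>: since
      \<open>b * (1 + 2 / m) = 1 / 2\<close>, the discarded volume has the same power of
      \<open>x\<close> as \<open>R\<close>.\<close>
    also have "b + (b - 1) * (2 / m) - 1 = - 1 / 2 - 2 / m"
    proof -
      have "m \<noteq> 0" "m + 2 \<noteq> 0" using m by auto
      then have half: "b * (1 + 2 / m) = 1 / 2" by (simp add: b_def divide_simps)
      have "b + (b - 1) * u - 1 = b * (1 + u) - (1 + u)" for u :: real
        by (simp add: algebra_simps)
      from this[of "2 / m"] show ?thesis unfolding half by simp
    qed
    also have "2 * outer_const TYPE('n) * C powr (1 + 2 / m) * x powr (- 1 / 2 - 2 / m)
        \<le> 2 * outer_const TYPE('n) * C powr (1 + 2 / m) * R"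
    proof (rule mult_left_mono)
      have "0 \<le> 1 + 2 / m" using m by simp
      then have "1 \<le> ln x powr (1 + 2 / m)" by (rule ge_one_powr_ge_zero[OF L(1)])
      then have "x powr (- 1 / 2 - 2 / m) * 1 \<le> R" unfolding R_def by (rule mult_left_mono) simp
      then show "x powr (- 1 / 2 - 2 / m) \<le> R" by simp
    qed (use outer_const_pos[where 'n = 'n] in \<open>auto simp: less_imp_le\<close>)
    finally show ?thesis by (simp add: \<beta>_def)
  qed
  let ?F = "\<lambda>X :: nat \<Rightarrow> real ^ 'n. measure lborel (ball_diff N X)"
  have F: "?F \<in> borel_measurable ?M"
    using measure_ball_diff_measurable[of "\<lambda>x. x" UNIV N] by simp
  have sg: "subgaussian ?M (\<integral>X. truncated_volume r N X \<partial>?M) (\<alpha> * R\<^sup>2) (truncated_volume r N)"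
    using truncated_volume_subgaussian[OF r0(1) r6(1) eps]
    unfolding d_def[symmetric] x_def[symmetric] var .
  have \<alpha>: "\<alpha> > 0" and \<beta>: "\<beta> \<ge> 0"
    using C diff_const_pos[where 'n = 'n] outer_const_pos[where 'n = 'n] by (auto simp: \<alpha>_def \<beta>_def less_imp_le)
  have close: "\<bar>?F X - truncated_volume r N X\<bar> \<le> \<beta> * R" if "X \<in> A" for X
    using A_close[OF that] close_le by (rule order_trans)
  note conc = conditional_concentration[where F = ?F and g = "truncated_volume r N" and A = A and M = ?M,
    OF prob_space_iid_sphere A A_half F truncated_volume_measurable truncated_volume_bounded close sg \<alpha> \<beta> R]
  have "AE X in cond_law N A. ball_diff N X \<in> fmeasurable lborel"
    unfolding cond_law_def
  proof (rule AE_uniform_measureI[OF A], rule AE_I2, rule impI)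
    fix X assume "X \<in> A"
    then show "ball_diff N X \<in> fmeasurable lborel"
      by (rule fmeasurable_bounded_borel[OF ball_diff_borel A_bd])
  qed
  then show ?thesis
    using prob_ge conc(1)[folded cond_law_def] conc(2)[folded cond_law_def]
    by (intro bexI[OF _ A] conjI allI impI)
qed

text \<open>The almost-everywhere and integrability clauses ensure that \<open>measure\<close> is a
  true volume and the integral a true expectation, not default values. The event is chosen before
  \<open>\<epsilon>\<close>, and the constants before \<open>N\<close>.\<close>

theorem corollary1p2:
  fixes n :: nat
  assumes "n = CARD('n::finite)" and "n \<ge> 2"
  shows "\<exists>c > 0. \<exists>c\<^sub>1 > 0. \<exists>N\<^sub>0. \<forall>N \<ge> N\<^sub>0.
    \<exists>A \<in> sets (iid_sphere N :: (nat \<Rightarrow> real ^ 'n) measure).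
      measure (iid_sphere N) A \<ge> 1 - exp (- c\<^sub>1 * real N powr (0.5 - 2 / (real n - 1)) * ln (real N)) \<and>
      (AE X in cond_law N A. ball_diff N X \<in> fmeasurable lborel) \<and>
      integrable (cond_law N A) (\<lambda>X. measure lborel (ball_diff N X)) \<and>
      (\<forall>\<epsilon> > 0.
        measure (cond_law N A)
          {X \<in> space (cond_law N A).
            \<bar>measure lborel (ball_diff N X)
              - (\<integral>Y. measure lborel (ball_diff N Y) \<partial>cond_law N A)\<bar> \<ge> \<epsilon>}
        \<le> 2 * exp (- c * real N powr (1 + 4 / (real n - 1))
                     * ln (real N) powr (- (2 + 4 / (real n - 1))) * \<epsilon>\<^sup>2))"
proof -
  define m where "m = real n - 1"
  define b where "b = m / (2 * (m + 2))"
  define C where "C = 2 / cap_const TYPE('n)"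
  define C' where "C' = ln 2 * sphere_area TYPE('n) / unit_ball_vol (real n - 1)"
  define \<alpha> where "\<alpha> = (diff_const TYPE('n))\<^sup>2 * (C powr (1 + 2 / m))\<^sup>2"
  define \<beta> where "\<beta> = 2 * outer_const TYPE('n) * C powr (1 + 2 / m)"
  have m: "m \<ge> 1" using assms by (simp add: m_def)
  have C: "C > 0" using cap_const_pos[where 'n = 'n] by (simp add: C_def)
  have b: "0 < b" "b < 1" using m by (auto simp: b_def field_simps)
  have ab: "0.5 - 2 / m < b"
  proof -
    \<comment> \<open>In this form the gap is visible; it absorbs both the logarithm and the factor
      2 in the failure probability, so that \<open>c\<^sub>1 = 1\<close> works.\<close>
    have "b = 1 / 2 - 1 / (m + 2)" using m by (simp add: b_def field_simps)
    moreover have "1 / (m + 2) < 2 / m" using m by (simp add: field_simps)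
    ultimately show ?thesis by simp
  qed
  have rate: "cond_rate \<alpha> \<beta> > 0"
    using C diff_const_pos[where 'n = 'n] outer_const_pos[where 'n = 'n]
    by (intro cond_rate_pos) (auto simp: \<alpha>_def \<beta>_def less_imp_le)
  have "\<forall>\<^sub>F N in sequentially. 1 \<le> ln (real N) \<and> ln (real N) \<le> real N powr b \<and> C * ln (real N) / real N \<le> (1 / 6) powr m \<and>
    C * real N powr (b - 1) \<le> (1 / 6) powr m \<and> C' \<le> C * ln (real N) \<and>
    2 * exp (- (real N powr b)) \<le> exp (- (real N powr (0.5 - 2 / m) * ln (real N))) \<and> 2 * exp (- (real N powr b)) \<le> 1 / 2"
    using filterlim_real_sequentially eventually_growth[OF b(1) ab b(2) C m, of C']
    by (rule eventually_compose_filterlim[rotated])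
  then obtain N\<^sub>0 where N\<^sub>0: "\<And>N. N \<ge> N\<^sub>0 \<Longrightarrow>
    1 \<le> ln (real N) \<and> ln (real N) \<le> real N powr b \<and> C * ln (real N) / real N \<le> (1 / 6) powr m \<and>
    C * real N powr (b - 1) \<le> (1 / 6) powr m \<and> C' \<le> C * ln (real N) \<and>
    2 * exp (- (real N powr b)) \<le> exp (- (real N powr (0.5 - 2 / m) * ln (real N))) \<and> 2 * exp (- (real N powr b)) \<le> 1 / 2"
    unfolding eventually_sequentially by blast
  show ?thesis
  proof (rule exI[of _ "cond_rate \<alpha> \<beta>"], rule conjI[OF rate], rule exI[of _ 1], rule conjI[OF zero_less_one],
      rule exI[of _ N\<^sub>0], intro allI impI)
    fix N assume "N \<ge> N\<^sub>0"
    note N = N\<^sub>0[OF this]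
    let ?x = "real N"
    let ?R = "?x powr (- 1 / 2 - 2 / m) * ln ?x powr (1 + 2 / m)"
    have "N \<noteq> 0" using N by (intro notI) simp
    then have "?x > 0" by simp
    have "ln ?x > 0" using N by linarith
    \<comment> \<open>Squaring the reciprocal of \<open>?R\<close> produces exactly the power of
      \<open>N\<close> and the logarithmic factor of the claim.\<close>
    have rate_eq: "- cond_rate \<alpha> \<beta> * (\<epsilon> / ?R)\<^sup>2
        = - cond_rate \<alpha> \<beta> * ?x powr (1 + 4 / m) * ln ?x powr (- (2 + 4 / m)) * \<epsilon>\<^sup>2" for \<epsilon>
    proof -
      have sq: "(u powr v)\<^sup>2 = u powr (2 * v)" if "u > 0" for u v :: real
        using that by (simp add: power2_eq_square flip: powr_add)
      have e: "2 * (- 1 / 2 - 2 / m) = - (1 + 4 / m)" "2 * (1 + 2 / m) = 2 + 4 / m" by simp_all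
      have swap: "\<epsilon>\<^sup>2 / (?x powr (- p) * ln ?x powr q) = ?x powr p * ln ?x powr (- q) * \<epsilon>\<^sup>2" for p q
        by (simp add: powr_minus divide_inverse mult_ac)
      have "(\<epsilon> / ?R)\<^sup>2 = \<epsilon>\<^sup>2 / (?x powr (- (1 + 4 / m)) * ln ?x powr (2 + 4 / m))"
        unfolding power_divide power_mult_distrib sq[OF \<open>?x > 0\<close>] sq[OF \<open>ln ?x > 0\<close>] e ..
      then show ?thesis unfolding swap by (simp only: mult.assoc)
    qed
    have large: "1 \<le> ln ?x" "ln ?x \<le> ?x powr b" "C * ln ?x / ?x \<le> (1 / 6) powr m"
      "C * ?x powr (b - 1) \<le> (1 / 6) powr m" "C' \<le> C * ln ?x" "2 * exp (- (?x powr b)) \<le> 1 / 2"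
      using N by simp_all
    note at = conditional_concentration_at[where 'n = 'n and N = N, folded assms(1), folded m_def C'_def,
      folded b_def C_def, folded \<alpha>_def \<beta>_def, OF assms(2) large]
    obtain A where A: "A \<in> sets (iid_sphere N :: (nat \<Rightarrow> real ^ 'n) measure)"
      "1 - 2 * exp (- (?x powr b)) \<le> measure (iid_sphere N) A"
      "AE X in cond_law N A. ball_diff N X \<in> fmeasurable lborel"
      "integrable (cond_law N A) (\<lambda>X. measure lborel (ball_diff N X))"
      "\<And>\<epsilon>. \<epsilon> > 0 \<Longrightarrow>
        measure (cond_law N A)
          {X \<in> space (cond_law N A).
            \<bar>measure lborel (ball_diff N X)
              - (\<integral>Y. measure lborel (ball_diff N Y) \<partial>cond_law N A)\<bar> \<ge> \<epsilon>}
        \<le> 2 * exp (- cond_rate \<alpha> \<beta> * (\<epsilon> / ?R)\<^sup>2)"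
      using at by (elim bexE conjE) (rule that; blast)
    have prob: "1 - exp (- 1 * ?x powr (0.5 - 2 / (real n - 1)) * ln ?x) \<le> measure (iid_sphere N) A"
      using A(2) N by (simp add: m_def)
    show "\<exists>A \<in> sets (iid_sphere N :: (nat \<Rightarrow> real ^ 'n) measure).
      measure (iid_sphere N) A \<ge> 1 - exp (- 1 * real N powr (0.5 - 2 / (real n - 1)) * ln (real N)) \<and>
      (AE X in cond_law N A. ball_diff N X \<in> fmeasurable lborel) \<and>
      integrable (cond_law N A) (\<lambda>X. measure lborel (ball_diff N X)) \<and>
      (\<forall>\<epsilon> > 0.
        measure (cond_law N A)
          {X \<in> space (cond_law N A).
            \<bar>measure lborel (ball_diff N X)
              - (\<integral>Y. measure lborel (ball_diff N Y) \<partial>cond_law N A)\<bar> \<ge> \<epsilon>}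
        \<le> 2 * exp (- cond_rate \<alpha> \<beta> * real N powr (1 + 4 / (real n - 1))
                     * ln (real N) powr (- (2 + 4 / (real n - 1))) * \<epsilon>\<^sup>2))"
      by (intro bexI[OF _ A(1)] conjI allI impI prob A(3,4) A(5)[unfolded rate_eq, unfolded m_def])
  qed
qed

end
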